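(* Let $\mathrm b\in\{\sharp,D\}$ (periodic or Dirichlet boundary conditions). The effective tensor $\bar{\mathfrak a}=\bar{\mathfrak a}_{\mathrm b}$, defined by $\mathfrak a(c+J,c+J)=|X|\,(c,\bar{\mathfrak a}c)$ with $J\in\mathcal H_{\mathrm b}$ the unique solution of $\mathfrak a(c+J,\tilde J)=0$ for all $\tilde J\in\mathcal H_{\mathrm b}$, obeys, for every $c\in\mathbb R^{D\times m}$, $$(c,\bar{\mathfrak a}c)=\min_{J\in\mathcal H_{\mathrm b}}\frac1{|X|}\,\mathfrak a(c+J,c+J).$$
   Context: $D$ is the spatial dimension, $m$ the number of currents, and $X\subset\mathbb R^D$ is a bounded open domain (a torus, identified with its fundamental cell, in the periodic case), with volume $|X|$. The fields $a\in C^1(X)\otimes\mathbb R^{(m-1)\times m}$ and $b\in C^1(X)\otimes\mathbb R^{1\times m}$ are bounded together with their first derivatives; pointwise $a$ has rank $m-1$ and the rows of $a$ and $b$ together span $\mathbb R^m$. The dual matrices $w$ ($(m-1)\times m$) and $u$ ($1\times m$), also $C^1$ and bounded together with their first derivatives, are defined by $wa^T=I_{m-1}$, $wb^T=0$, $ua^T=0$, $ub^T=1$. $\eta$ is a bounded symmetric matrix field with $\eta\ge\eta_0>0$ and $\zeta\ge0$ is a bounded function. $\langle\cdot,\cdot\rangle$ is the $L^2(X)$ inner product of tensor-valued functions, $(c,d)=\mathrm{Tr}(c^Td)$. For $\mathbb R^{D\times m}$-valued fields, $$\mathfrak a(J,\tilde J)=\langle Jw^T,\tilde Jw^T\rangle+\langle\eta\nabla(Ju^T),\nabla(\tilde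 Ju^T)\rangle+\langle\zeta\,\nabla\cdot(Ju^T),\nabla\cdot(\tilde Ju^T)\rangle .$$ Currents are $J=\nabla\cdot f$, $J_{lk}=\sum_j\partial_jf^j_{lk}$, with $f$ antisymmetric: $f^j_{lk}+f^l_{jk}=0$ ($1\le j,l\le D$, $1\le k\le m$). $\mathfrak D_\sharp$: currents $\nabla\cdot f$ with $f$ smooth, antisymmetric and periodic. $\mathfrak D_D$: currents $\nabla\cdot f$ with $f$ smooth, antisymmetric, $f=0$ and $(\nabla\cdot f)u^T=0$ on $\partial X$. It is assumed that the oscillation $\mathfrak O=\min_{\theta\in\mathbb S^{D-1}}\max_{1\le j\le m}\int_X(\theta\cdot\nabla b_j)^2dx$ is positive; then $\mathfrak a$ is an inner product on $\mathfrak D_\sharp$ and $\mathfrak D_D$, and $\mathcal H_\sharp$, $\mathcal H_D$ denote their completions for the norm generated by $\mathfrak a$. The form $\mathfrak a$ extends to $\mathbb R^{D\times m}\oplus\mathcal H_{\mathrm b}$ (constants added), and $\bar{\mathfrak a}$ is a symmetric linear map $\mathbb R^{D\times m}\to\mathbb R^{D\times m}$, which is well defined because the solution $J$ is unique and linear in $c$. *)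

theory Defs
  imports "HOL-Analysis.Analysis"
begin

section \<open>Differential operators\<close>

definition pd :: "'d::finite \<Rightarrow> (real^'d \<Rightarrow> 'v::real_normed_vector) \<Rightarrow> real^'d \<Rightarrow> 'v" where
  "pd j g x = frechet_derivative g (at x) (axis j 1)"

text \<open>The first index of \<open>grad v\<close> is the one of the derivative; it is the index on which
  the matrix field \<open>\<eta>\<close> of the form below acts.\<close>

definition grad :: "(real^'d \<Rightarrow> real^'d) \<Rightarrow> real^'d \<Rightarrow> real^'d^'d::finite" where
  "grad v x = (\<chi> j l. pd j v x $ l)"

definition dvg :: "(real^'d \<Rightarrow> real^'d) \<Rightarrow> real^'d::finite \<Rightarrow> real" where
  "dvg v x = (\<Sum>l\<in>UNIV. pd l v x $ l)"

text \<open>Tensor potentials are indexed as \<open>f x $ j $ l $ k\<close>, with \<open>k\<close> numbering the currents.\<close>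

definition tdvg :: "(real^'d \<Rightarrow> real^'m^'d^'d) \<Rightarrow> real^'d \<Rightarrow> real^'m^'d::finite" where
  "tdvg f x = (\<chi> l k. \<Sum>j\<in>UNIV. pd j f x $ j $ l $ k)"

definition antisymmetric :: "(real^'d \<Rightarrow> real^'m^'d^'d) \<Rightarrow> bool" where
  "antisymmetric f \<longleftrightarrow> (\<forall>x j l k. f x $ j $ l $ k + f x $ l $ j $ k = 0)"

text \<open>Differentiability of all iterated partial derivatives makes all of them continuous, so
  this is \<open>C\<^sup>\<infinity>\<close> on the whole space.\<close>

definition smooth :: "(real^'d::finite \<Rightarrow> 'v::real_normed_vector) \<Rightarrow> bool" where
  "smooth f \<longleftrightarrow> (\<forall>js x. foldr pd js f differentiable (at x))"

definition C1_bounded_on :: "(real^'d::finite) set \<Rightarrow> (real^'d \<Rightarrow> 'v::real_normed_vector) \<Rightarrow> bool" where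
  "C1_bounded_on S g \<longleftrightarrow>
     (\<forall>x\<in>S. g differentiable (at x)) \<and> (\<forall>j. continuous_on S (pd j g)) \<and>
     bounded (g ` S) \<and> (\<forall>j. bounded (pd j g ` S))"


section \<open>Boundary conditions, domains and fields\<close>

text \<open>In \<open>Periodic L\<close> the columns of \<open>L\<close> generate the lattice of periods. Functions on the torus
  are periodic functions on the whole space, and \<open>X\<close> is the open fundamental cell.\<close>

datatype ('d::finite) bc = Periodic "real^'d^'d" | Dirichlet

definition periodic :: "real^'d^'d \<Rightarrow> (real^'d \<Rightarrow> 'v) \<Rightarrow> bool" where
  "periodic L g \<longleftrightarrow> (\<forall>x i. g (x + column i L) = g x)"

fun is_domain :: "'d::finite bc \<Rightarrow> (real^'d) set \<Rightarrow> bool" where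
  "is_domain (Periodic L) X \<longleftrightarrow>
     invertible L \<and> X = (\<lambda>t. L *v t) ` {t. \<forall>i. 0 < t $ i \<and> t $ i < 1}"
| "is_domain Dirichlet X \<longleftrightarrow> X \<noteq> {} \<and> open X \<and> connected X \<and> bounded X"

fun field_dom :: "'d::finite bc \<Rightarrow> (real^'d) set \<Rightarrow> (real^'d) set" where
  "field_dom (Periodic L) X = UNIV"
| "field_dom Dirichlet X = X"

fun C1_field :: "'d::finite bc \<Rightarrow> (real^'d) set \<Rightarrow> (real^'d \<Rightarrow> 'v::real_normed_vector) \<Rightarrow> bool" where
  "C1_field (Periodic L) X g \<longleftrightarrow> C1_bounded_on UNIV g \<and> periodic L g"
| "C1_field Dirichlet X g \<longleftrightarrow> C1_bounded_on X g"

text \<open>The infimum over the sphere is a minimum, by compactness.\<close>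

definition oscillation :: "(real^'d) set \<Rightarrow> (real^'d \<Rightarrow> real^'m) \<Rightarrow> real" where
  "oscillation X b =
     (INF \<theta>\<in>sphere (0 :: real^'d::finite) 1.
        Max (range (\<lambda>k::'m::finite.
          LINT x|lebesgue_on X. (\<Sum>j\<in>UNIV. \<theta> $ j * pd j b x $ k)\<^sup>2)))"


section \<open>Currents and the form\<close>

text \<open>Smoothness up to the boundary means being the restriction of a smooth function on the whole
  space. Since \<open>u\<close> is only given on \<open>X\<close> in the Dirichlet case, the
  second boundary condition is read as a limit from inside.\<close>

fun boundary_condition ::
  "'d::finite bc \<Rightarrow> (real^'d) set \<Rightarrow> (real^'d \<Rightarrow> real^'m) \<Rightarrow> (real^'d \<Rightarrow> real^'m^'d^'d) \<Rightarrow> bool" where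
  "boundary_condition (Periodic L) X u f \<longleftrightarrow> periodic L f"
| "boundary_condition Dirichlet X u f \<longleftrightarrow>
     (\<forall>p\<in>frontier X. f p = 0 \<and> ((\<lambda>x. tdvg f x *v u x) \<longlongrightarrow> 0) (at p within X))"

text \<open>A current on \<open>X\<close> is represented by its extension by zero, so that currents that agree on
  \<open>X\<close> are equal.\<close>

definition currents ::
  "'d::finite bc \<Rightarrow> (real^'d) set \<Rightarrow> (real^'d \<Rightarrow> real^'m) \<Rightarrow> (real^'d \<Rightarrow> real^'m^'d) set" where
  "currents bc X u =
     {(\<lambda>x. if x \<in> X then tdvg f x else 0) | f.
        smooth f \<and> antisymmetric f \<and> boundary_condition bc X u f}"

text \<open>The \<open>m - 1\<close> rows of \<open>w\<close> are numbered by naturals, which allows \<open>m = 1\<close>. The inner product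
  of \<open>real^'d^'d\<close> is the Frobenius inner product.\<close>

definition form ::
  "(real^'d) set \<Rightarrow> (nat \<Rightarrow> real^'d \<Rightarrow> real^'m) \<Rightarrow> (real^'d \<Rightarrow> real^'m) \<Rightarrow>
   (real^'d \<Rightarrow> real^'d^'d) \<Rightarrow> (real^'d \<Rightarrow> real) \<Rightarrow>
   (real^'d::finite \<Rightarrow> real^'m::finite^'d) \<Rightarrow> (real^'d \<Rightarrow> real^'m^'d) \<Rightarrow> real" where
  "form X w u \<eta> \<zeta> J K =
     (LINT x|lebesgue_on X. (\<Sum>i<CARD('m) - 1. (J x *v w i x) \<bullet> (K x *v w i x))) +
     (LINT x|lebesgue_on X.
        (\<eta> x ** grad (\<lambda>y. J y *v u y) x) \<bullet> grad (\<lambda>y. K y *v u y) x) +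
     (LINT x|lebesgue_on X.
        (\<zeta> x * dvg (\<lambda>y. J y *v u y) x) * dvg (\<lambda>y. K y *v u y) x)"


section \<open>Completion\<close>

text \<open>Cauchy sequences modulo null sequences, for the norm \<open>sqrt (B v v)\<close> on \<open>V\<close>.\<close>

definition cauchy_seqs :: "'v::minus set \<Rightarrow> ('v \<Rightarrow> 'v \<Rightarrow> real) \<Rightarrow> (nat \<Rightarrow> 'v) set" where
  "cauchy_seqs V B =
     {S. (\<forall>n. S n \<in> V) \<and>
         (\<forall>e>0. \<exists>N. \<forall>p\<ge>N. \<forall>q\<ge>N. sqrt (B (S p - S q) (S p - S q)) < e)}"

definition null_rel :: "'v::minus set \<Rightarrow> ('v \<Rightarrow> 'v \<Rightarrow> real) \<Rightarrow> ((nat \<Rightarrow> 'v) \<times> (nat \<Rightarrow> 'v)) set" where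
  "null_rel V B =
     {(S, T). S \<in> cauchy_seqs V B \<and> T \<in> cauchy_seqs V B \<and>
        (\<lambda>n. sqrt (B (S n - T n) (S n - T n))) \<longlonglongrightarrow> 0}"

definition cauchy_completion :: "'v::minus set \<Rightarrow> ('v \<Rightarrow> 'v \<Rightarrow> real) \<Rightarrow> (nat \<Rightarrow> 'v) set set" where
  "cauchy_completion V B = cauchy_seqs V B // null_rel V B"

text \<open>The continuous extension of a form \<open>B\<close> on currents to pairs \<open>(c, h)\<close>, that is \<open>c + h\<close> with a
  constant \<open>c\<close> and an element \<open>h\<close> of the completion.\<close>

definition ext_form ::
  "((real^'d \<Rightarrow> real^'m^'d) \<Rightarrow> (real^'d \<Rightarrow> real^'m^'d) \<Rightarrow> real) \<Rightarrow>
   (real^'m^'d) \<times> (nat \<Rightarrow> real^'d::finite \<Rightarrow> real^'m^'d) set \<Rightarrow>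
   (real^'m::finite^'d) \<times> (nat \<Rightarrow> real^'d \<Rightarrow> real^'m^'d) set \<Rightarrow> real" where
  "ext_form B p q =
     (THE r. \<forall>S\<in>snd p. \<forall>T\<in>snd q.
        (\<lambda>n. B (\<lambda>x. fst p + S n x) (\<lambda>x. fst q + T n x)) \<longlonglongrightarrow> r)"


section \<open>The effective tensor\<close>

definition is_corrector ::
  "(real^'d \<Rightarrow> real^'m^'d) set \<Rightarrow> ((real^'d \<Rightarrow> real^'m^'d) \<Rightarrow> (real^'d \<Rightarrow> real^'m^'d) \<Rightarrow> real) \<Rightarrow>
   real^'m::finite^'d::finite \<Rightarrow> (nat \<Rightarrow> real^'d \<Rightarrow> real^'m^'d) set \<Rightarrow> bool" where
  "is_corrector V B c J \<longleftrightarrow>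
     J \<in> cauchy_completion V B \<and> (\<forall>K\<in>cauchy_completion V B. ext_form B (c, J) (0, K) = 0)"

definition corrector ::
  "(real^'d \<Rightarrow> real^'m^'d) set \<Rightarrow> ((real^'d \<Rightarrow> real^'m^'d) \<Rightarrow> (real^'d \<Rightarrow> real^'m^'d) \<Rightarrow> real) \<Rightarrow>
   real^'m::finite^'d::finite \<Rightarrow> (nat \<Rightarrow> real^'d \<Rightarrow> real^'m^'d) set" where
  "corrector V B c = (THE J. is_corrector V B c J)"

definition is_effective_tensor ::
  "(real^'d) set \<Rightarrow>
   (real^'d \<Rightarrow> real^'m^'d) set \<Rightarrow> ((real^'d \<Rightarrow> real^'m^'d) \<Rightarrow> (real^'d \<Rightarrow> real^'m^'d) \<Rightarrow> real) \<Rightarrow>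
   (real^'m^'d \<Rightarrow> real^'m::finite^'d::finite) \<Rightarrow> bool" where
  "is_effective_tensor X V B A \<longleftrightarrow>
     linear A \<and> (\<forall>c d. c \<bullet> A d = A c \<bullet> d) \<and>
     (\<forall>c. ext_form B (c, corrector V B c) (c, corrector V B c) =
            measure lebesgue X * (c \<bullet> A c))"

definition effective_tensor ::
  "(real^'d) set \<Rightarrow>
   (real^'d \<Rightarrow> real^'m^'d) set \<Rightarrow> ((real^'d \<Rightarrow> real^'m^'d) \<Rightarrow> (real^'d \<Rightarrow> real^'m^'d) \<Rightarrow> real) \<Rightarrow>
   real^'m^'d \<Rightarrow> real^'m::finite^'d::finite" where
  "effective_tensor X V B = (THE A. is_effective_tensor X V B A)"

end

theory Submission
  imports Defs "HOL-Library.Function_Algebras"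
begin

text \<open>By the parallelogram identity, a sequence \<open>S\<close> of currents minimizing the energy
  \<open>f \<mapsto> \<aa> (c + f) (c + f)\<close> is Cauchy, and comparing the energies of \<open>S n\<close> and
  \<open>S n + t K\<close> shows that \<open>\<aa> (c + S n) K\<close> tends to zero uniformly for bounded \<open>K\<close>. So the
  class of \<open>S\<close> is the corrector \<open>J c\<close>, and orthogonality makes it a minimizer. Orthogonality also
  gives \<open>\<aa> (c + J c) (d + J d) = \<aa> (c + J c) d\<close>, a symmetric bilinear form in \<open>(c, d)\<close>, which the
  effective tensor represents.\<close>

section \<open>Completion of a semidefinite form\<close>

text \<open>Two obstacles shape the development. An integral is additive only on integrable
  functions, so the form obeys the laws of an inner product only where its integrands are
  integrable. The laws are therefore stated relative to a space \<open>W\<close>, later the fields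
  that are bounded and \<open>C1\<close> on \<open>X\<close>. It contains the currents and the
  constants, so \<open>c + J\<close> can be handled inside one space. The elements of the completion
  are classes of sequences and \<open>ext_form\<close> is a description of a limit. Arguments run on
  representatives, once the limits are known to exist and not to depend on the choice. A minimizing
  sequence consists of currents, so it already represents an element of the completion, and
  uniqueness of the corrector means uniqueness of a class. One discriminant bound serves twice: with
  the energy of a field as constant term it gives Cauchy-Schwarz, and with the excess over the
  infimum as constant term it gives near-orthogonality of a near-minimizer.\<close>

lemma discriminant_nonpos:
  fixes b e q :: real
  assumes "\<And>t. 0 \<le> e + 2 * t * b + t\<^sup>2 * q" "0 \<le> q" "0 \<le> e"
  shows "b\<^sup>2 \<le> e * q"
proof (cases "q = 0")
  case True
  have "b = 0"
  proof (rule ccontr)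
    assume "b \<noteq> 0"
    \<comment> \<open>With \<open>q = 0\<close> the expression is affine in \<open>t\<close>; this
      \<open>t\<close> gives it the value \<open>-1\<close>.\<close>
    then show False
      using assms(1)[of "- (e + 1) / (2 * b)"] True by (simp add: field_simps)
  qed
  then show ?thesis using True by simp
next
  case False
  then have "q > 0" using assms(2) by simp
  \<comment> \<open>\<open>t = - b / q\<close> is the vertex of the parabola.\<close>
  then have "e + 2 * (- b / q) * b + (- b / q)\<^sup>2 * q = e - b\<^sup>2 / q"
    by (simp add: field_simps power2_eq_square)
  then have "b\<^sup>2 / q \<le> e" using assms(1)[of "- b / q"] by simp
  then show ?thesis using \<open>q > 0\<close> by (simp add: field_simps)
qed

text \<open>Here \<open>x\<close> and \<open>y\<close> are the energies of two near-minimizers,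
  \<open>z\<close> their mixed term and \<open>q\<close> the energy of their midpoint. Then
  \<open>x - 2 * z + y = 2 * x + 2 * y - 4 * q\<close>, and the multiples of the infimum
  \<open>d\<close> cancel.\<close>

lemma parallelogram_bound:
  fixes x y q d e z :: real
  assumes "x < d + e / 4" "y < d + e / 4" "d \<le> q" "q = (x + 2 * z + y) / 4"
  shows "x - 2 * z + y < e"
  using assms by simp

text \<open>The scaling is a parameter because the intended vectors are functions, scaled
  pointwise.\<close>

locale psd_form = vector_space scale
  for scale :: "real \<Rightarrow> 'v::ab_group_add \<Rightarrow> 'v" (infixr \<open>\<odot>\<close> 75) +
  fixes W :: "'v set" and B :: "'v \<Rightarrow> 'v \<Rightarrow> real"
  assumes subspace_W: "subspace W"
    and form_add_left: "f \<in> W \<Longrightarrow> g \<in> W \<Longrightarrow> h \<in> W \<Longrightarrow> B (f + g) h = B f h + B g h"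
    and form_scale_left: "f \<in> W \<Longrightarrow> g \<in> W \<Longrightarrow> B (r \<odot> f) g = r * B f g"
    and form_commute: "f \<in> W \<Longrightarrow> g \<in> W \<Longrightarrow> B f g = B g f"
    and form_nonneg: "f \<in> W \<Longrightarrow> 0 \<le> B f f"
begin

abbreviation "N f \<equiv> sqrt (B f f)"

lemmas W_closed [simp] = subspace_add[OF subspace_W] subspace_diff[OF subspace_W]
  subspace_scale[OF subspace_W] subspace_0[OF subspace_W]

lemma form_add_right: "f \<in> W \<Longrightarrow> g \<in> W \<Longrightarrow> h \<in> W \<Longrightarrow> B h (f + g) = B h f + B h g"
  by (metis form_add_left form_commute W_closed(1))

lemma form_scale_right: "f \<in> W \<Longrightarrow> g \<in> W \<Longrightarrow> B f (r \<odot> g) = r * B f g"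
  by (metis form_scale_left form_commute W_closed(3))

lemma form_diff_left: "f \<in> W \<Longrightarrow> g \<in> W \<Longrightarrow> h \<in> W \<Longrightarrow> B (f - g) h = B f h - B g h"
  using form_add_left[of "f - g" g h] by simp

lemma form_diff_right: "f \<in> W \<Longrightarrow> g \<in> W \<Longrightarrow> h \<in> W \<Longrightarrow> B h (f - g) = B h f - B h g"
  using form_add_right[of "f - g" g h] by simp

lemma form_zero_left [simp]: "f \<in> W \<Longrightarrow> B 0 f = 0"
  using form_add_left[of 0 0 f] by simp

lemmas form_simps = form_add_left form_add_right form_scale_left form_scale_right
  form_diff_left form_diff_right

lemma form_add_scale_self:
  "f \<in> W \<Longrightarrow> g \<in> W \<Longrightarrow> B (f + t \<odot> g) (f + t \<odot> g) = B f f + 2 * t * B f g + t\<^sup>2 * B g g"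
  using form_commute[of f g] by (simp add: form_simps algebra_simps power2_eq_square)

lemma form_diff_self: "f \<in> W \<Longrightarrow> g \<in> W \<Longrightarrow> B (f - g) (f - g) = B f f - 2 * B f g + B g g"
  using form_commute[of f g] by (simp add: form_simps)

text \<open>A semidefinite quadratic form is convex and lies above its tangent at \<open>f\<close>.
  This later turns orthogonality into minimality.\<close>

lemma form_tangent_le:
  assumes "f \<in> W" "g \<in> W"
  shows "B f f + 2 * B f (g - f) \<le> B g g"
  using form_nonneg[of "g - f"] form_diff_self[of g f] form_commute[of f g] assms
  by (simp add: form_diff_right)

lemma Cauchy_Schwarz:
  assumes "f \<in> W" "g \<in> W"
  shows "\<bar>B f g\<bar> \<le> N f * N g"
proof -
  have "(B f g)\<^sup>2 \<le> B f f * B g g"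
  proof (rule discriminant_nonpos)
    show "0 \<le> B f f + 2 * t * B f g + t\<^sup>2 * B g g" for t
      using form_nonneg[of "f + t \<odot> g"] assms by (simp add: form_add_scale_self)
  qed (use assms form_nonneg in auto)
  then have "sqrt ((B f g)\<^sup>2) \<le> sqrt (B f f * B g g)" by (rule real_sqrt_le_mono)
  then show ?thesis by (simp add: real_sqrt_mult)
qed

lemma N_add_le:
  assumes "f \<in> W" "g \<in> W"
  shows "N (f + g) \<le> N f + N g"
proof -
  have "B (f + g) (f + g) = B f f + 2 * B f g + B g g"
    using form_add_scale_self[of f g 1] assms by simp
  also have "\<dots> \<le> B f f + 2 * (N f * N g) + B g g"
    using Cauchy_Schwarz[OF assms] by simp
  also have "\<dots> = (N f + N g)\<^sup>2"
    using assms form_nonneg by (simp add: power2_sum)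
  finally have "N (f + g) \<le> sqrt ((N f + N g)\<^sup>2)"
    by (rule real_sqrt_le_mono)
  then show ?thesis using assms form_nonneg by simp
qed

lemma N_uminus_diff: "f \<in> W \<Longrightarrow> g \<in> W \<Longrightarrow> N (f - g) = N (g - f)"
  using form_commute[of f g] by (simp add: form_simps)

lemma N_diff_triangle:
  "f \<in> W \<Longrightarrow> g \<in> W \<Longrightarrow> h \<in> W \<Longrightarrow> N (f - h) \<le> N (f - g) + N (g - h)"
  using N_add_le[of "f - g" "g - h"] by simp

text \<open>Changing one argument at a time gives a Lipschitz bound, the source of both the
  existence of the limits and their independence of representatives.\<close>

lemma form_diff_le:
  assumes "f \<in> W" "g \<in> W" "f' \<in> W" "g' \<in> W"
  shows "\<bar>B f g - B f' g'\<bar> \<le> N (f - f') * N g + N f' * N (g - g')"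
proof -
  have "B f g - B f' g' = B (f - f') g + B f' (g - g')"
    using assms by (simp add: form_simps)
  then show ?thesis
    using Cauchy_Schwarz[of "f - f'" g] Cauchy_Schwarz[of f' "g - g'"] assms by simp
qed

section \<open>Cauchy sequences and null sequences\<close>

lemma cauchy_seqsD:
  assumes "S \<in> cauchy_seqs V B"
  shows "S n \<in> V" "e > 0 \<Longrightarrow> \<exists>k. \<forall>p\<ge>k. \<forall>q\<ge>k. N (S p - S q) < e"
  using assms by (auto simp: cauchy_seqs_def)

lemma cauchy_seqs_mono: "V \<subseteq> W \<Longrightarrow> S \<in> cauchy_seqs V B \<Longrightarrow> S \<in> cauchy_seqs W B"
  by (auto simp: cauchy_seqs_def)

lemma translate_in_cauchy_seqs:
  "c \<in> W \<Longrightarrow> S \<in> cauchy_seqs W B \<Longrightarrow> (\<lambda>n. c + S n) \<in> cauchy_seqs W B"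
  by (auto simp: cauchy_seqs_def)

lemma diff_in_cauchy_seqs:
  assumes "subspace V" "V \<subseteq> W" "S \<in> cauchy_seqs V B" "T \<in> cauchy_seqs V B"
  shows "(\<lambda>n. S n - T n) \<in> cauchy_seqs V B"
  unfolding cauchy_seqs_def
proof (intro CollectI conjI allI impI)
  show "S n - T n \<in> V" for n
    using assms by (auto intro: subspace_diff cauchy_seqsD)
  fix e :: real assume "e > 0"
  then obtain k l where k: "\<forall>p\<ge>k. \<forall>q\<ge>k. N (S p - S q) < e / 2"
    and l: "\<forall>p\<ge>l. \<forall>q\<ge>l. N (T p - T q) < e / 2"
    using cauchy_seqsD(2)[OF assms(3), of "e / 2"] cauchy_seqsD(2)[OF assms(4), of "e / 2"] by auto
  have W: "S n \<in> W" "T n \<in> W" for n using assms cauchy_seqsD by blast+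
  have "N (S p - T p - (S q - T q)) < e" if "p \<ge> max k l" "q \<ge> max k l" for p q
  proof -
    have eq: "S p - T p - (S q - T q) = (S p - S q) + (T q - T p)" by simp
    have "N (S p - T p - (S q - T q)) \<le> N (S p - S q) + N (T q - T p)"
      unfolding eq by (intro N_add_le) (use W in simp_all)
    also have "\<dots> < e / 2 + e / 2" using k l that by (intro add_strict_mono) auto
    finally show ?thesis by simp
  qed
  then show "\<exists>k. \<forall>p\<ge>k. \<forall>q\<ge>k. N (S p - T p - (S q - T q)) < e" by blast
qed

lemma cauchy_seqs_bounded:
  assumes "S \<in> cauchy_seqs W B"
  obtains M where "M > 0" "\<And>n. N (S n) \<le> M"
proof -
  obtain k where k: "\<forall>p\<ge>k. \<forall>q\<ge>k. N (S p - S q) < 1"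
    using cauchy_seqsD(2)[OF assms zero_less_one] by blast
  \<comment> \<open>The maximum covers the indices up to \<open>k\<close>; the added 1 covers the
    tail, which stays within distance 1 of \<open>S k\<close>. It also makes \<open>M\<close>
    strictly positive, so that it can be a divisor later.\<close>
  define M where "M = Max ((\<lambda>n. N (S n)) ` {..k}) + 1"
  have small: "N (S n) \<le> Max ((\<lambda>n. N (S n)) ` {..k})" if "n \<le> k" for n
    using that by auto
  have W: "S n \<in> W" for n using assms cauchy_seqsD by blast
  have "N (S n) \<le> M" for n
  proof (cases "n \<le> k")
    case True then show ?thesis using small[OF True] unfolding M_def by linarith
  next
    case False
    have "N (S n) \<le> N (S n - S k) + N (S k)" using N_add_le[of "S n - S k" "S k"] W by simp
    moreover have "N (S n - S k) < 1" using k False by simp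
    ultimately show ?thesis using small[OF order_refl] unfolding M_def by linarith
  qed
  moreover have "M > 0"
    using small[OF le0] form_nonneg[OF W[of 0]] real_sqrt_ge_zero[of "B (S 0) (S 0)"]
    unfolding M_def by linarith
  ultimately show ?thesis using that by blast
qed

lemma form_convergent:
  assumes "S \<in> cauchy_seqs W B" "T \<in> cauchy_seqs W B"
  shows "convergent (\<lambda>n. B (S n) (T n))"
  unfolding Cauchy_convergent_iff[symmetric]
proof (rule metric_CauchyI)
  fix e :: real assume "e > 0"
  obtain M where M: "M > 0" "\<And>n. N (S n) \<le> M" by (rule cauchy_seqs_bounded[OF assms(1)]) blast
  obtain L where L: "L > 0" "\<And>n. N (T n) \<le> L" by (rule cauchy_seqs_bounded[OF assms(2)]) blast
  have W: "S n \<in> W" "T n \<in> W" for n using assms cauchy_seqsD by blast+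
  \<comment> \<open>In \<open>form_diff_le\<close> the distance of the \<open>S\<close> terms is
    multiplied by at most \<open>L\<close> and that of the \<open>T\<close> terms by at most
    \<open>M\<close>, so each product contributes \<open>e / 2\<close>.\<close>
  have "0 < e / (2 * L)" "0 < e / (2 * M)" using M(1) L(1) \<open>e > 0\<close> by simp_all
  then obtain k l where k: "\<forall>p\<ge>k. \<forall>q\<ge>k. N (S p - S q) < e / (2 * L)"
    and l: "\<forall>p\<ge>l. \<forall>q\<ge>l. N (T p - T q) < e / (2 * M)"
    using cauchy_seqsD(2)[OF assms(1)] cauchy_seqsD(2)[OF assms(2)] by meson
  have "dist (B (S p) (T p)) (B (S q) (T q)) < e" if "p \<ge> max k l" "q \<ge> max k l" for p q
  proof -
    have "dist (B (S p) (T p)) (B (S q) (T q)) \<le> N (S p - S q) * N (T p) + N (S q) * N (T p - T q)"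
      using form_diff_le[of "S p" "T p" "S q" "T q"] W by (simp add: dist_real_def)
    also have "\<dots> \<le> N (S p - S q) * L + M * N (T p - T q)"
      using M L W form_nonneg by (intro add_mono mult_mono) auto
    also have "\<dots> < e / (2 * L) * L + M * (e / (2 * M))"
      using M(1) L(1) k l that by (intro add_strict_mono mult_strict_right_mono mult_strict_left_mono) auto
    finally show ?thesis using M(1) L(1) by simp
  qed
  then show "\<exists>k. \<forall>p\<ge>k. \<forall>q\<ge>k. dist (B (S p) (T p)) (B (S q) (T q)) < e" by blast
qed

text \<open>Equivalent representatives produce the same limit, which is what makes
  \<open>ext_form\<close> meaningful.\<close>

lemma form_diff_tendsto_zero:
  assumes "(S, S') \<in> null_rel W B" "(T, T') \<in> null_rel W B"
  shows "(\<lambda>n. B (S n) (T n) - B (S' n) (T' n)) \<longlonglongrightarrow> 0"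
proof -
  have C: "S \<in> cauchy_seqs W B" "S' \<in> cauchy_seqs W B" "T \<in> cauchy_seqs W B" "T' \<in> cauchy_seqs W B"
    and lims: "(\<lambda>n. N (S n - S' n)) \<longlonglongrightarrow> 0" "(\<lambda>n. N (T n - T' n)) \<longlonglongrightarrow> 0"
    using assms by (auto simp: null_rel_def)
  obtain M where M: "M > 0" "\<And>n. N (S' n) \<le> M" by (rule cauchy_seqs_bounded[OF C(2)]) blast
  obtain L where L: "L > 0" "\<And>n. N (T n) \<le> L" by (rule cauchy_seqs_bounded[OF C(3)]) blast
  have W: "S n \<in> W" "T n \<in> W" "S' n \<in> W" "T' n \<in> W" for n using C cauchy_seqsD by blast+
  show ?thesis
  proof (rule Lim_null_comparison)
    show "(\<lambda>n. N (S n - S' n) * L + M * N (T n - T' n)) \<longlonglongrightarrow> 0"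
      by (rule tendsto_eq_intros lims refl | simp)+
    have "\<bar>B (S n) (T n) - B (S' n) (T' n)\<bar> \<le> N (S n - S' n) * L + M * N (T n - T' n)" for n
    proof -
      have "N (S n - S' n) * N (T n) + N (S' n) * N (T n - T' n)
          \<le> N (S n - S' n) * L + M * N (T n - T' n)"
        using M L W form_nonneg by (intro add_mono mult_mono) auto
      then show ?thesis using form_diff_le[of "S n" "T n" "S' n" "T' n"] W by fastforce
    qed
    then show "\<forall>\<^sub>F n in sequentially. norm (B (S n) (T n) - B (S' n) (T' n))
        \<le> N (S n - S' n) * L + M * N (T n - T' n)" by simp
  qed
qed

text \<open>The translation cancels in differences. The relation moves from \<open>V\<close> to
  \<open>W\<close> because \<open>c + S n\<close> need not lie in \<open>V\<close>.\<close>

lemma null_rel_translate: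
  "c \<in> W \<Longrightarrow> V \<subseteq> W \<Longrightarrow> (S, T) \<in> null_rel V B \<Longrightarrow> ((\<lambda>n. c + S n), (\<lambda>n. c + T n)) \<in> null_rel W B"
  by (auto simp: null_rel_def intro: translate_in_cauchy_seqs cauchy_seqs_mono)

lemma equiv_null_rel:
  assumes "V \<subseteq> W"
  shows "equiv (cauchy_seqs V B) (null_rel V B)"
proof (rule equivI)
  show "null_rel V B \<subseteq> cauchy_seqs V B \<times> cauchy_seqs V B"
    by (auto simp: null_rel_def)
  show "refl_on (cauchy_seqs V B) (null_rel V B)"
    by (auto simp: refl_on_def null_rel_def)
  have W: "S n \<in> W" if "S \<in> cauchy_seqs V B" for S n using that assms cauchy_seqsD by blast
  show "sym (null_rel V B)"
  proof (rule symI)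
    fix S T assume "(S, T) \<in> null_rel V B"
    then show "(T, S) \<in> null_rel V B"
      using W N_uminus_diff[of "T _" "S _"] by (simp add: null_rel_def)
  qed
  show "trans (null_rel V B)"
  proof (rule transI)
    fix S T U assume *: "(S, T) \<in> null_rel V B" "(T, U) \<in> null_rel V B"
    then have C: "S \<in> cauchy_seqs V B" "T \<in> cauchy_seqs V B" "U \<in> cauchy_seqs V B"
      and lims: "(\<lambda>n. N (S n - T n)) \<longlonglongrightarrow> 0" "(\<lambda>n. N (T n - U n)) \<longlonglongrightarrow> 0"
      by (auto simp: null_rel_def)
    have "(\<lambda>n. N (S n - U n)) \<longlonglongrightarrow> 0"
    proof (rule Lim_null_comparison)
      show "(\<lambda>n. N (S n - T n) + N (T n - U n)) \<longlonglongrightarrow> 0"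
        using tendsto_add[OF lims] by simp
      show "\<forall>\<^sub>F n in sequentially. norm (N (S n - U n)) \<le> N (S n - T n) + N (T n - U n)"
        using N_diff_triangle[of "S _" "T _" "U _"] W C form_nonneg by simp
    qed
    then show "(S, U) \<in> null_rel V B" using C by (simp add: null_rel_def)
  qed
qed

section \<open>Representatives of classes in the completion\<close>

lemma completion_subset:
  "V \<subseteq> W \<Longrightarrow> J \<in> cauchy_completion V B \<Longrightarrow> S \<in> J \<Longrightarrow> S \<in> cauchy_seqs V B"
  unfolding cauchy_completion_def using in_quotient_imp_subset[OF equiv_null_rel] by blast

lemma completion_ex_seq: "V \<subseteq> W \<Longrightarrow> J \<in> cauchy_completion V B \<Longrightarrow> \<exists>S. S \<in> J"
  unfolding cauchy_completion_def using in_quotient_imp_non_empty[OF equiv_null_rel] by blast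

lemma completion_null_rel:
  "V \<subseteq> W \<Longrightarrow> J \<in> cauchy_completion V B \<Longrightarrow> S \<in> J \<Longrightarrow> T \<in> J \<Longrightarrow> (S, T) \<in> null_rel V B"
  unfolding cauchy_completion_def using in_quotient_imp_in_rel[OF equiv_null_rel] by blast

lemma completion_class:
  "V \<subseteq> W \<Longrightarrow> S \<in> cauchy_seqs V B \<Longrightarrow> \<exists>J\<in>cauchy_completion V B. S \<in> J"
  unfolding cauchy_completion_def using equiv_class_self[OF equiv_null_rel] by (blast intro: quotientI)

lemma completion_eqI:
  "V \<subseteq> W \<Longrightarrow> J \<in> cauchy_completion V B \<Longrightarrow> K \<in> cauchy_completion V B \<Longrightarrow> S \<in> J \<Longrightarrow> T \<in> K \<Longrightarrow>
    (S, T) \<in> null_rel V B \<Longrightarrow> J = K"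
  unfolding cauchy_completion_def using quotient_eqI[OF equiv_null_rel] by blast

text \<open>The test functions form a sequence paired with \<open>S\<close> along the diagonal, as
  this is how \<open>ext_form\<close> pairs \<open>c + J\<close> with an element of the
  completion.\<close>

lemma ex_orthogonal_cauchy_seq:
  assumes V: "subspace V" "V \<subseteq> W" and c: "c \<in> W"
  shows "\<exists>S\<in>cauchy_seqs V B. \<forall>T\<in>cauchy_seqs V B. (\<lambda>n. B (c + S n) (T n)) \<longlonglongrightarrow> 0"
proof -
  define Q where "Q f = B (c + f) (c + f)" for f
  have VW: "f \<in> W" if "f \<in> V" for f using that V by blast
  have Q0: "0 \<le> Q f" if "f \<in> V" for f using VW[OF that] c by (simp add: Q_def form_nonneg)
  define d where "d = (INF f\<in>V. Q f)"
  have bdd: "bdd_below (Q ` V)" using Q0 by (intro bdd_belowI2)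
  have ne: "V \<noteq> {}" using subspace_0[OF V(1)] by blast
  have d_le: "d \<le> Q f" if "f \<in> V" for f using bdd that by (simp add: d_def cINF_lower)
  have "\<exists>f\<in>V. Q f < d + 1 / real (Suc n)" for n
    using cINF_less_iff[OF ne bdd, of "d + 1 / real (Suc n)"] by (simp add: d_def)
  then obtain S where S: "\<And>n. S n \<in> V" "\<And>n. Q (S n) < d + 1 / real (Suc n)" by metis
  have inv0: "(\<lambda>n. 1 / real (Suc n)) \<longlonglongrightarrow> 0"
    using LIMSEQ_inverse_real_of_nat by (simp add: inverse_eq_divide)
  have cauchy: "S \<in> cauchy_seqs V B"
    unfolding cauchy_seqs_def
  proof (intro CollectI conjI allI impI S(1))
    fix e :: real assume "e > 0"
    \<comment> \<open>\<open>N\<close> is a square root, so the energy of the difference has to drop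
      below \<open>e\<^sup>2\<close>; the parallelogram estimate costs a factor 4.\<close>
    then have "0 < e\<^sup>2 / 4" by simp
    then obtain k where k: "1 / real (Suc k) < e\<^sup>2 / 4"
      using nat_approx_posE by blast
    have "N (S p - S q) < e" if "p \<ge> k" "q \<ge> k" for p q
    proof -
      let ?x = "c + S p" and ?y = "c + S q"
      let ?m = "(1/2) \<odot> (S p + S q)"
      have m: "?m \<in> V" using S(1) V(1) by (simp add: subspace_add subspace_scale)
      \<comment> \<open>Halving \<open>c\<close> makes \<open>c + ?m\<close> the midpoint of
        \<open>?x\<close> and \<open>?y\<close> although only currents are averaged. Since
        \<open>?m\<close> stays in \<open>V\<close>, its energy is at least
        \<open>d\<close>.\<close>
      have "c = (1/2) \<odot> c + (1/2) \<odot> c" by (simp add: scale_left_distrib[symmetric])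
      then have mid: "c + ?m = (1/2) \<odot> (?x + ?y)"
        by (simp add: scale_right_distrib add_ac)
      have W: "?x \<in> W" "?y \<in> W" using S(1) VW c by auto
      have 1: "Q ?m = (B ?x ?x + 2 * B ?x ?y + B ?y ?y) / 4"
        unfolding Q_def mid form_scale_left[OF W_closed(1)[OF W] W_closed(3)[OF W_closed(1)[OF W]]]
          form_scale_right[OF W_closed(1)[OF W] W_closed(1)[OF W]]
        using form_add_scale_self[OF W, of 1] by simp
      have 2: "B (S p - S q) (S p - S q) = B ?x ?x - 2 * B ?x ?y + B ?y ?y"
        using form_diff_self[OF W] by simp
      have "B (c + S n) (c + S n) < d + e\<^sup>2 / 4" if "n \<ge> k" for n
      proof -
        have "B (c + S n) (c + S n) < d + 1 / real (Suc n)" using S(2)[of n] by (simp only: Q_def)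
        also have "\<dots> \<le> d + 1 / real (Suc k)" using that by (simp add: frac_le)
        also have "\<dots> < d + e\<^sup>2 / 4" using k by simp
        finally show ?thesis .
      qed
      note bounds = this[OF that(1)] this[OF that(2)]
      have "B (S p - S q) (S p - S q) < e\<^sup>2"
        unfolding 2 by (rule parallelogram_bound[OF bounds d_le[OF m] 1])
      then have "N (S p - S q) < sqrt (e\<^sup>2)" by (rule real_sqrt_less_mono)
      then show ?thesis using \<open>e > 0\<close> by simp
    qed
    then show "\<exists>k. \<forall>p\<ge>k. \<forall>q\<ge>k. N (S p - S q) < e" by blast
  qed
  have "(\<lambda>n. B (c + S n) (T n)) \<longlonglongrightarrow> 0" if T: "T \<in> cauchy_seqs V B" for T
  proof -
    obtain M where M: "M > 0" "\<And>n. N (T n) \<le> M"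
      using cauchy_seqs_bounded cauchy_seqs_mono V(2) T by metis
    have TV: "T n \<in> V" for n using T cauchy_seqsD by blast
    have "\<bar>B (c + S n) (T n)\<bar> \<le> sqrt (1 / real (Suc n)) * M" for n
    proof -
      \<comment> \<open>The infimum is a lower bound at \<open>S n + t \<odot> T n\<close> for every
        \<open>t\<close>, and the energy of \<open>S n\<close> exceeds it by less than
        \<open>1 / real (Suc n)\<close>, the constant term of the quadratic.\<close>
      have "(B (c + S n) (T n))\<^sup>2 \<le> 1 / real (Suc n) * B (T n) (T n)"
      proof (rule discriminant_nonpos)
        fix t
        have "S n + t \<odot> T n \<in> V" using S(1) TV V(1) by (simp add: subspace_add subspace_scale)
        then have "d \<le> B ((c + S n) + t \<odot> T n) ((c + S n) + t \<odot> T n)"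
          using d_le unfolding Q_def by (simp add: add.assoc)
        also have "\<dots> = Q (S n) + 2 * t * B (c + S n) (T n) + t\<^sup>2 * B (T n) (T n)"
          unfolding Q_def using VW S(1) TV c by (intro form_add_scale_self) auto
        finally show "0 \<le> 1 / real (Suc n) + 2 * t * B (c + S n) (T n) + t\<^sup>2 * B (T n) (T n)"
          using S(2)[of n] by linarith
      qed (use VW TV form_nonneg in auto)
      then have "sqrt ((B (c + S n) (T n))\<^sup>2) \<le> sqrt (1 / real (Suc n) * B (T n) (T n))"
        by (rule real_sqrt_le_mono)
      also have "\<dots> = sqrt (1 / real (Suc n)) * N (T n)" by (rule real_sqrt_mult)
      also have "\<dots> \<le> sqrt (1 / real (Suc n)) * M" using M by (intro mult_left_mono) auto
      finally show ?thesis by simp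
    qed
    then have "\<forall>\<^sub>F n in sequentially. norm (B (c + S n) (T n)) \<le> sqrt (1 / real (Suc n)) * M"
      by (intro always_eventually) (simp only: real_norm_def, blast)
    moreover have "(\<lambda>n. sqrt (1 / real (Suc n)) * M) \<longlonglongrightarrow> 0"
      using tendsto_mult_left_zero[OF tendsto_real_sqrt[OF inv0, unfolded real_sqrt_zero]] .
    ultimately show ?thesis by (rule Lim_null_comparison)
  qed
  with cauchy show ?thesis by blast
qed

end


section \<open>Correctors and the effective tensor\<close>

text \<open>The completion is formed from \<open>V\<close>, the currents, while the form is
  evaluated on \<open>W\<close>, which has room for currents shifted by constants.\<close>

locale function_form =
  psd_form "\<lambda>r f x. r *\<^sub>R f x" W B
  for W :: "(real^'d::finite \<Rightarrow> real^'m::finite^'d) set" and B +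
  fixes V :: "(real^'d \<Rightarrow> real^'m^'d) set"
  assumes subspace_V: "subspace V" and V_subset: "V \<subseteq> W"
    and const_in_W [simp]: "(\<lambda>_. c) \<in> W"
begin

abbreviation "H \<equiv> cauchy_completion V B"

text \<open>This discharges the definite description: from here on \<open>ext_form\<close> is
  computed along any convenient pair of representatives.\<close>

lemma ext_form_tendsto:
  assumes J: "J \<in> H" "S \<in> J" and K: "K \<in> H" "T \<in> K"
  shows "(\<lambda>n. B ((\<lambda>_. c) + S n) ((\<lambda>_. d) + T n)) \<longlonglongrightarrow> ext_form B (c, J) (d, K)"
proof -
  let ?B = "\<lambda>S T n. B ((\<lambda>_. c) + S n) ((\<lambda>_. d) + T n)"
  have shift: "(\<lambda>n. (\<lambda>_. e) + R n) \<in> cauchy_seqs W B" if "L \<in> H" "R \<in> L" for e L R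
    using completion_subset[OF V_subset that] cauchy_seqs_mono[OF V_subset] translate_in_cauchy_seqs
    by simp
  obtain r where r: "?B S T \<longlonglongrightarrow> r"
    using form_convergent[OF shift[OF J] shift[OF K], of c d] unfolding convergent_def by blast
  have rep: "?B S' T' \<longlonglongrightarrow> r" if "S' \<in> J" "T' \<in> K" for S' T'
  proof -
    have "(\<lambda>n. ?B S' T' n - ?B S T n) \<longlonglongrightarrow> 0"
      using completion_null_rel[OF V_subset J(1) that(1) J(2)]
        completion_null_rel[OF V_subset K(1) that(2) K(2)]
      by (intro form_diff_tendsto_zero null_rel_translate[OF _ V_subset]) auto
    from tendsto_add[OF this r] show ?thesis by simp
  qed
  have "ext_form B (c, J) (d, K) = r"
    unfolding ext_form_def
  proof (rule the_equality)
    show "\<forall>S\<in>snd (c, J). \<forall>T\<in>snd (d, K).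
        (\<lambda>n. B (\<lambda>x. fst (c, J) + S n x) (\<lambda>x. fst (d, K) + T n x)) \<longlonglongrightarrow> r"
      using rep by (simp add: plus_fun_def)
    fix r' assume "\<forall>S\<in>snd (c, J). \<forall>T\<in>snd (d, K).
        (\<lambda>n. B (\<lambda>x. fst (c, J) + S n x) (\<lambda>x. fst (d, K) + T n x)) \<longlonglongrightarrow> r'"
    then have "?B S T \<longlonglongrightarrow> r'" using J K by (simp add: plus_fun_def)
    then show "r' = r" using r LIMSEQ_unique by blast
  qed
  with r show ?thesis by simp
qed

text \<open>Every Cauchy sequence lies in a class and every class has a representative, so testing
  against classes and testing against sequences agree.\<close>

lemma is_corrector_iff:
  assumes "J \<in> H" "S \<in> J"
  shows "is_corrector V B c J \<longleftrightarrow> (\<forall>T\<in>cauchy_seqs V B. (\<lambda>n. B ((\<lambda>_. c) + S n) (T n)) \<longlonglongrightarrow> 0)"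
    (is "_ \<longleftrightarrow> ?orth")
proof -
  have zero: "(\<lambda>_. 0) + f = f" for f :: "real^'d \<Rightarrow> real^'m^'d" by (simp add: plus_fun_def)
  have lim: "(\<lambda>n. B ((\<lambda>_. c) + S n) (T n)) \<longlonglongrightarrow> ext_form B (c, J) (0, K)"
    if "K \<in> H" "T \<in> K" for K T
    using ext_form_tendsto[OF assms that, of c 0] by (simp only: zero)
  show ?thesis
  proof
    assume *: "is_corrector V B c J"
    show ?orth
    proof
      fix T assume "T \<in> cauchy_seqs V B"
      then obtain K where "K \<in> H" "T \<in> K" using completion_class[OF V_subset] by blast
      then show "(\<lambda>n. B ((\<lambda>_. c) + S n) (T n)) \<longlonglongrightarrow> 0"
        using lim[of K T] * by (simp add: is_corrector_def)
    qed
  next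
    assume *: ?orth
    have "ext_form B (c, J) (0, K) = 0" if K: "K \<in> H" for K
    proof -
      obtain T where "T \<in> K" using completion_ex_seq[OF V_subset K] by blast
      then show ?thesis
        using lim[OF K] * completion_subset[OF V_subset K] LIMSEQ_unique by blast
    qed
    with assms show "is_corrector V B c J" by (simp add: is_corrector_def)
  qed
qed

lemma ex1_corrector: "\<exists>!J. is_corrector V B c J"
proof (rule ex_ex1I)
  obtain S where S: "S \<in> cauchy_seqs V B"
    "\<forall>T\<in>cauchy_seqs V B. (\<lambda>n. B ((\<lambda>_. c) + S n) (T n)) \<longlonglongrightarrow> 0"
    using ex_orthogonal_cauchy_seq[OF subspace_V V_subset const_in_W] by blast
  obtain J where "J \<in> H" "S \<in> J" using completion_class[OF V_subset S(1)] by blast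
  with S(2) show "\<exists>J. is_corrector V B c J" using is_corrector_iff by blast
next
  fix J K assume JK: "is_corrector V B c J" "is_corrector V B c K"
  then have H: "J \<in> H" "K \<in> H" by (auto simp: is_corrector_def)
  then obtain S T where ST: "S \<in> J" "T \<in> K" using completion_ex_seq[OF V_subset] by metis
  have C: "S \<in> cauchy_seqs V B" "T \<in> cauchy_seqs V B"
    using completion_subset[OF V_subset] H ST by blast+
  then have D: "(\<lambda>n. S n - T n) \<in> cauchy_seqs V B"
    using diff_in_cauchy_seqs[OF subspace_V V_subset] by blast
  have W: "S n \<in> W" "T n \<in> W" for n using C cauchy_seqsD V_subset by blast+
  \<comment> \<open>Both orthogonality relations are tested with \<open>S n - T n\<close>.
    Subtracting them leaves the energy of this difference, so the two representatives are
    equivalent.\<close>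
  have "(\<lambda>n. B ((\<lambda>_. c) + S n) (S n - T n) - B ((\<lambda>_. c) + T n) (S n - T n)) \<longlonglongrightarrow> 0 - 0"
    using JK is_corrector_iff[OF H(1) ST(1)] is_corrector_iff[OF H(2) ST(2)] D
    by (intro tendsto_diff) auto
  moreover have "B ((\<lambda>_. c) + S n) (S n - T n) - B ((\<lambda>_. c) + T n) (S n - T n)
      = B (S n - T n) (S n - T n)" for n
    using W by (simp add: form_simps)
  ultimately have "(\<lambda>n. B (S n - T n) (S n - T n)) \<longlonglongrightarrow> 0" by simp
  from tendsto_real_sqrt[OF this] have "(S, T) \<in> null_rel V B"
    using C by (simp add: null_rel_def)
  then show "J = K" using completion_eqI[OF V_subset H ST] by blast
qed

abbreviation "corr \<equiv> corrector V B"

lemma is_corrector_corr: "is_corrector V B c (corr c)"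
  unfolding corrector_def by (rule theI'[OF ex1_corrector])

lemma corr_in_H: "corr c \<in> H"
  using is_corrector_corr by (simp add: is_corrector_def)

lemma corr_ex_seq:
  obtains S where "S \<in> corr c" "\<And>n. S n \<in> W"
    "\<And>T. T \<in> cauchy_seqs V B \<Longrightarrow> (\<lambda>n. B ((\<lambda>_. c) + S n) (T n)) \<longlonglongrightarrow> 0"
proof -
  obtain S where S: "S \<in> corr c" using completion_ex_seq[OF V_subset corr_in_H] by blast
  then have "S n \<in> W" for n
    using completion_subset[OF V_subset corr_in_H] cauchy_seqsD(1) V_subset by blast
  with S show ?thesis using is_corrector_iff[OF corr_in_H S] is_corrector_corr that by blast
qed

text \<open>The polarized effective energy, which is the volume of \<open>X\<close> times the
  bilinear form of the effective tensor. With correctors in both slots its symmetry is that of the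
  form.\<close>

definition eff :: "real^'m^'d \<Rightarrow> real^'m^'d \<Rightarrow> real" where
  "eff c d = ext_form B (c, corr c) (d, corr d)"

text \<open>By orthogonality the second corrector may be dropped, which makes \<open>eff c\<close> linear without
  knowing that the corrector depends linearly on \<open>c\<close>.\<close>

lemma eff_tendsto:
  assumes "S \<in> corr c"
  shows "(\<lambda>n. B ((\<lambda>_. c) + S n) (\<lambda>_. d)) \<longlonglongrightarrow> eff c d"
proof -
  obtain T where T: "T \<in> corr d" using completion_ex_seq[OF V_subset corr_in_H] by blast
  have TC: "T \<in> cauchy_seqs V B" by (rule completion_subset[OF V_subset corr_in_H T])
  have W: "T n \<in> W" "S n \<in> W" for n
    using TC completion_subset[OF V_subset corr_in_H assms] cauchy_seqsD(1) V_subset by blast+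
  have "(\<lambda>n. B ((\<lambda>_. c) + S n) ((\<lambda>_. d) + T n) - B ((\<lambda>_. c) + S n) (T n)) \<longlonglongrightarrow> eff c d - 0"
    unfolding eff_def
    using is_corrector_iff[OF corr_in_H assms] is_corrector_corr TC
    by (intro tendsto_diff ext_form_tendsto corr_in_H assms T) blast
  moreover have "B ((\<lambda>_. c) + S n) ((\<lambda>_. d) + T n) - B ((\<lambda>_. c) + S n) (T n)
      = B ((\<lambda>_. c) + S n) (\<lambda>_. d)" for n
    using W by (simp add: form_add_right)
  ultimately show ?thesis by simp
qed

text \<open>With one representative of \<open>corr c\<close> fixed, all values of
  \<open>eff c\<close> are limits along the same sequence, and linearity in the constant passes to
  the limit.\<close>

lemma linear_eff: "linear (eff c)"
proof (rule linearI)
  obtain S where S: "S \<in> corr c" "\<And>n. S n \<in> W" by (rule corr_ex_seq[of c]) blast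
  fix d e
  have "(\<lambda>n. B ((\<lambda>_. c) + S n) (\<lambda>_. d + e)) \<longlonglongrightarrow> eff c d + eff c e"
  proof -
    have "B ((\<lambda>_. c) + S n) (\<lambda>_. d + e) = B ((\<lambda>_. c) + S n) (\<lambda>_. d) + B ((\<lambda>_. c) + S n) (\<lambda>_. e)" for n
    proof -
      have "(\<lambda>_::real^'d. d + e) = (\<lambda>_. d) + (\<lambda>_. e)" by (simp add: plus_fun_def)
      then show ?thesis using S(2) by (simp add: form_add_right)
    qed
    then show ?thesis
      using tendsto_add[OF eff_tendsto[OF S(1), of d] eff_tendsto[OF S(1), of e]] by (simp only:)
  qed
  then show "eff c (d + e) = eff c d + eff c e"
    using eff_tendsto[OF S(1)] LIMSEQ_unique by blast
  fix r
  have "(\<lambda>n. B ((\<lambda>_. c) + S n) (\<lambda>_. r *\<^sub>R d)) \<longlonglongrightarrow> r *\<^sub>R eff c d"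
  proof -
    have "B ((\<lambda>_. c) + S n) (\<lambda>_. r *\<^sub>R d) = r * B ((\<lambda>_. c) + S n) (\<lambda>_. d)" for n
      using S(2) by (intro form_scale_right) simp_all
    then show ?thesis using tendsto_mult_left[OF eff_tendsto[OF S(1), of d], of r] by simp
  qed
  then show "eff c (r *\<^sub>R d) = r *\<^sub>R eff c d"
    using eff_tendsto[OF S(1)] LIMSEQ_unique by blast
qed

lemma eff_commute: "eff c d = eff d c"
proof -
  obtain S where S: "S \<in> corr c" "\<And>n. S n \<in> W" by (rule corr_ex_seq[of c]) blast
  obtain T where T: "T \<in> corr d" "\<And>n. T n \<in> W" by (rule corr_ex_seq[of d]) blast
  have "(\<lambda>n. B ((\<lambda>_. c) + S n) ((\<lambda>_. d) + T n)) \<longlonglongrightarrow> eff c d"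
    "(\<lambda>n. B ((\<lambda>_. d) + T n) ((\<lambda>_. c) + S n)) \<longlonglongrightarrow> eff d c"
    unfolding eff_def by (intro ext_form_tendsto corr_in_H S T)+
  moreover have "B ((\<lambda>_. c) + S n) ((\<lambda>_. d) + T n) = B ((\<lambda>_. d) + T n) ((\<lambda>_. c) + S n)" for n
    using S T by (intro form_commute) auto
  ultimately show ?thesis using LIMSEQ_unique by fastforce
qed

text \<open>The tangent inequality at \<open>c + S n\<close> has a linear term that vanishes in the
  limit by orthogonality.\<close>

lemma eff_le:
  assumes J: "J \<in> H"
  shows "eff c c \<le> ext_form B (c, J) (c, J)"
proof -
  obtain S where S: "S \<in> corr c" "\<And>n. S n \<in> W"
    and orth: "\<And>T. T \<in> cauchy_seqs V B \<Longrightarrow> (\<lambda>n. B ((\<lambda>_. c) + S n) (T n)) \<longlonglongrightarrow> 0"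
    by (rule corr_ex_seq[of c]) blast
  obtain T where T: "T \<in> J" using completion_ex_seq[OF V_subset J] by blast
  have C: "S \<in> cauchy_seqs V B" "T \<in> cauchy_seqs V B"
    using completion_subset[OF V_subset] corr_in_H J S(1) T by blast+
  have W: "T n \<in> W" for n using C cauchy_seqsD V_subset by blast
  have orth': "(\<lambda>n. B ((\<lambda>_. c) + S n) (T n - S n)) \<longlonglongrightarrow> 0"
    using orth diff_in_cauchy_seqs[OF subspace_V V_subset C(2) C(1)] by blast
  have "B ((\<lambda>_. c) + S n) ((\<lambda>_. c) + S n) + 2 * B ((\<lambda>_. c) + S n) (T n - S n)
      \<le> B ((\<lambda>_. c) + T n) ((\<lambda>_. c) + T n)" for n
  proof -
    let ?x = "(\<lambda>_. c) + S n" and ?y = "(\<lambda>_. c) + T n"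
    have xy: "?x \<in> W" "?y \<in> W" using S(2) W by auto
    \<comment> \<open>The constants cancel, so the tangent direction consists of currents and is an
      admissible test sequence.\<close>
    have "T n - S n = ?y - ?x" by simp
    then show ?thesis using form_tangent_le[OF xy] by (simp only:)
  qed
  moreover have "(\<lambda>n. B ((\<lambda>_. c) + S n) ((\<lambda>_. c) + S n) + 2 * B ((\<lambda>_. c) + S n) (T n - S n))
      \<longlonglongrightarrow> eff c c + 2 * 0"
    unfolding eff_def by (intro tendsto_intros orth' ext_form_tendsto corr_in_H S)
  moreover have "(\<lambda>n. B ((\<lambda>_. c) + T n) ((\<lambda>_. c) + T n)) \<longlonglongrightarrow> ext_form B (c, J) (c, J)"
    by (intro ext_form_tendsto J T)
  ultimately have "eff c c + 2 * 0 \<le> ext_form B (c, J) (c, J)"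
    by (intro LIMSEQ_le) auto
  then show ?thesis by simp
qed

lemma ex1_effective_tensor:
  fixes X :: "(real^'d) set"
  assumes "measure lebesgue X > 0"
  shows "\<exists>!A. is_effective_tensor X V B A"
proof (rule ex_ex1I)
  \<comment> \<open>The Riesz representative of \<open>eff c\<close>, divided by the volume, written
    in the orthonormal basis.\<close>
  define A where "A c = (\<Sum>e\<in>Basis. (eff c e / measure lebesgue X) *\<^sub>R e)" for c
  have inner_A: "A c \<bullet> d = eff c d / measure lebesgue X" for c d
  proof -
    have "A c \<bullet> d = (\<Sum>e\<in>Basis. eff c e / measure lebesgue X * (e \<bullet> d))"
      by (simp only: A_def inner_sum_left inner_scaleR_left)
    also have "\<dots> = (\<Sum>e\<in>Basis. eff c ((d \<bullet> e) *\<^sub>R e)) / measure lebesgue X"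
      by (simp add: sum_divide_distrib linear_cmul[OF linear_eff] inner_commute mult.commute)
    also have "\<dots> = eff c d / measure lebesgue X"
      by (simp only: linear_sum[OF linear_eff, symmetric] euclidean_representation)
    finally show ?thesis .
  qed
  have "linear A"
  proof (rule linearI)
    show "A (c + d) = A c + A d" for c d
    proof (rule euclidean_eqI)
      fix e :: "real^'m^'d"
      have "eff (c + d) e = eff c e + eff d e"
        using linear_add[OF linear_eff] by (metis eff_commute)
      then show "A (c + d) \<bullet> e = (A c + A d) \<bullet> e"
        by (simp add: inner_A inner_add_left add_divide_distrib)
    qed
    show "A (r *\<^sub>R c) = r *\<^sub>R A c" for r c
    proof (rule euclidean_eqI)
      fix e :: "real^'m^'d"
      have "eff (r *\<^sub>R c) e = r * eff c e"
        using linear_cmul[OF linear_eff] by (metis eff_commute real_scaleR_def)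
      then show "A (r *\<^sub>R c) \<bullet> e = (r *\<^sub>R A c) \<bullet> e" by (simp add: inner_A)
    qed
  qed
  then have "is_effective_tensor X V B A"
    unfolding is_effective_tensor_def
  proof (intro conjI allI)
    show "c \<bullet> A d = A c \<bullet> d" for c d
      using inner_A[of d c] inner_A[of c d] eff_commute[of c d] by (simp only: inner_commute[of c])
    show "ext_form B (c, corr c) (c, corr c) = measure lebesgue X * (c \<bullet> A c)" for c
      using assms inner_A[of c c] by (simp add: inner_commute[of c] eff_def)
  qed
  then show "\<exists>A. is_effective_tensor X V B A" by blast
next
  fix A A' assume *: "is_effective_tensor X V B A" "is_effective_tensor X V B A'"
  show "A = A'"
  proof
    fix c
    have quad: "d \<bullet> A d = d \<bullet> A' d" for d
    proof -
      have "measure lebesgue X * (d \<bullet> A d) = measure lebesgue X * (d \<bullet> A' d)"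
        using * unfolding is_effective_tensor_def by metis
      then show ?thesis using assms by simp
    qed
    \<comment> \<open>Polarization: the quadratic form at \<open>c + d\<close>, less its values at
      \<open>c\<close> and \<open>d\<close>, is twice the mixed term by symmetry.\<close>
    have "A c \<bullet> d = A' c \<bullet> d" for d
    proof -
      have sym: "c \<bullet> A d = A c \<bullet> d" "c \<bullet> A' d = A' c \<bullet> d"
        and add: "A (c + d) = A c + A d" "A' (c + d) = A' c + A' d"
        using * by (auto simp: is_effective_tensor_def linear_add)
      show ?thesis
        using quad[of "c + d"] quad[of c] quad[of d] sym
        by (simp add: add inner_add_left inner_add_right inner_commute)
    qed
    then have "\<forall>d. A c \<bullet> d = A' c \<bullet> d" by blast
    then show "A c = A' c" by (rule vector_eq_rdot[THEN iffD1])
  qed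
qed

lemma inner_effective_tensor:
  fixes X :: "(real^'d) set"
  assumes "measure lebesgue X > 0"
  shows "c \<bullet> effective_tensor X V B c = 1 / measure lebesgue X * eff c c"
proof -
  have "is_effective_tensor X V B (effective_tensor X V B)"
    unfolding effective_tensor_def by (rule theI'[OF ex1_effective_tensor[OF assms]])
  then show ?thesis using assms by (simp add: is_effective_tensor_def eff_def)
qed

end


section \<open>Calculus of fields\<close>

text \<open>Uniqueness of the Frechet derivative lets each rule for \<open>pd\<close> be read off
  the matching rule for \<open>has_derivative\<close>.\<close>

lemma pd_eqI: "(g has_derivative D) (at x) \<Longrightarrow> pd j g x = D (axis j 1)"
  unfolding pd_def by (simp add: frechet_derivative_at[symmetric])

lemma differentiable_has_derivative:
  "g differentiable (at x) \<Longrightarrow> (g has_derivative frechet_derivative g (at x)) (at x)"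
  by (simp add: frechet_derivative_works)

lemma pd_const [simp]: "pd j (\<lambda>_. c) = (\<lambda>_. 0)"
  by (rule ext, subst pd_eqI[OF has_derivative_const]) simp

lemma pd_add:
  assumes "f differentiable (at x)" "g differentiable (at x)"
  shows "pd j (\<lambda>y. f y + g y) x = pd j f x + pd j g x"
  by (subst pd_eqI[OF has_derivative_add[OF assms[THEN differentiable_has_derivative]]])
    (simp add: pd_def)

lemma pd_bounded_linear:
  assumes "bounded_linear L" "f differentiable (at x)"
  shows "pd j (\<lambda>y. L (f y)) x = L (pd j f x)"
  by (subst pd_eqI[OF bounded_linear.has_derivative[OF assms(1) differentiable_has_derivative[OF assms(2)]]])
    (simp add: pd_def)

lemma pd_bounded_bilinear:
  assumes "bounded_bilinear h" "f differentiable (at x)" "g differentiable (at x)"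
  shows "pd j (\<lambda>y. h (f y) (g y)) x = h (f x) (pd j g x) + h (pd j f x) (g x)"
  by (subst pd_eqI[OF bounded_bilinear.FDERIV[OF assms(1) assms(2,3)[THEN differentiable_has_derivative]]])
    (simp add: pd_def)

text \<open>Derivatives are local on open sets. This serves currents, whose extension by zero agrees
  with \<open>tdvg f\<close> on the open domain.\<close>

lemma
  assumes "f differentiable (at x)" "open S" "x \<in> S" "\<And>y. y \<in> S \<Longrightarrow> f y = g y"
  shows differentiable_transform_open: "g differentiable (at x)"
    and pd_transform_open: "pd j g x = pd j f x"
proof -
  have "(g has_derivative frechet_derivative f (at x)) (at x)"
    using has_derivative_transform_within_open[OF differentiable_has_derivative[OF assms(1)] assms(2-4)] .
  then show "g differentiable (at x)" "pd j g x = pd j f x"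
    by (auto simp: differentiable_def pd_eqI pd_def[of j f])
qed

lemma bounded_bilinear_matrix_vector:
  "bounded_bilinear (\<lambda>(A :: real^'n^'m) x. A *v x)"
  unfolding bilinear_conv_bounded_bilinear[symmetric] bilinear_def
  by (auto intro!: linearI simp: algebra_simps scaleR_matrix_vector_assoc
      matrix_vector_mult_scaleR)

lemma bounded_bilinear_matrix_mult:
  "bounded_bilinear (\<lambda>(A :: real^'n^'m) (B :: real^'k^'n). A ** B)"
  unfolding bilinear_conv_bounded_bilinear[symmetric] bilinear_def
  by (auto intro!: linearI
      simp: matrix_matrix_mult_def vec_eq_iff algebra_simps sum.distrib sum_distrib_left)

lemma bounded_linear_axis: "bounded_linear (axis j :: 'a::euclidean_space \<Rightarrow> 'a^'n)"
  unfolding linear_conv_bounded_linear[symmetric] by (rule linearI) (auto simp: axis_def vec_eq_iff)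

lemma bounded_bilinear_image:
  assumes "bounded_bilinear h" "bounded (f ` S)" "bounded (g ` S)"
  shows "bounded ((\<lambda>x. h (f x) (g x)) ` S)"
proof -
  obtain a b where a: "\<And>x. x \<in> S \<Longrightarrow> norm (f x) \<le> a" and b: "\<And>x. x \<in> S \<Longrightarrow> norm (g x) \<le> b"
    using assms(2,3) by (auto simp: bounded_iff)
  obtain K where K: "0 \<le> K" "\<And>x y. norm (h x y) \<le> norm x * norm y * K"
    using bounded_bilinear.nonneg_bounded[OF assms(1)] by blast
  have "norm (h (f x) (g x)) \<le> a * b * K" if "x \<in> S" for x
  proof -
    have "norm (f x) * norm (g x) * K \<le> a * b * K"
      using a[OF that] b[OF that] K(1) order_trans[OF norm_ge_zero a[OF that]]
      by (intro mult_right_mono mult_mono) auto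
    then show ?thesis using K(2)[of "f x" "g x"] by linarith
  qed
  then show ?thesis by (auto simp: bounded_iff)
qed

lemma bounded_linear_image_comp: "bounded_linear L \<Longrightarrow> bounded (f ` S) \<Longrightarrow> bounded ((\<lambda>x. L (f x)) ` S)"
  using bounded_linear_image[of "f ` S" L] by (simp add: image_image)

lemma bounded_sum_comp:
  fixes f :: "'i \<Rightarrow> 'a \<Rightarrow> 'b::real_normed_vector"
  shows "(\<And>i. i \<in> I \<Longrightarrow> bounded (f i ` S)) \<Longrightarrow> bounded ((\<lambda>x. \<Sum>i\<in>I. f i x) ` S)"
proof (induction I rule: infinite_finite_induct)
  case (insert i I)
  then show ?case using bounded_plus_comp[of "f i" S "\<lambda>x. \<Sum>i\<in>I. f i x"] by simp
qed (auto simp: bounded_iff intro: exI[of _ 0])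

section \<open>Closure properties of bounded \<open>C1\<close> fields\<close>

lemma C1_bounded_on_subset: "C1_bounded_on T g \<Longrightarrow> S \<subseteq> T \<Longrightarrow> C1_bounded_on S g"
  unfolding C1_bounded_on_def
  by (auto intro: continuous_on_subset bounded_subset[OF _ image_mono])

lemma C1_bounded_on_continuous: "C1_bounded_on S g \<Longrightarrow> continuous_on S g"
  unfolding C1_bounded_on_def
  by (intro differentiable_imp_continuous_on differentiable_at_imp_differentiable_on) auto

lemma C1_bounded_on_const: "C1_bounded_on S (\<lambda>_. c)"
  by (auto simp: C1_bounded_on_def bounded_iff)

lemma C1_bounded_on_add:
  assumes "C1_bounded_on S f" "C1_bounded_on S g"
  shows "C1_bounded_on S (\<lambda>x. f x + g x)"
proof -
  have eq: "pd j (\<lambda>x. f x + g x) x = pd j f x + pd j g x" if "x \<in> S" for x j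
    using assms that by (intro pd_add) (auto simp: C1_bounded_on_def)
  have "continuous_on S (\<lambda>x. pd j f x + pd j g x)" "bounded ((\<lambda>x. pd j f x + pd j g x) ` S)"
    "bounded ((\<lambda>x. f x + g x) ` S)" for j
    using assms by (auto simp: C1_bounded_on_def intro!: continuous_intros bounded_plus_comp)
  then show ?thesis
    using assms eq by (auto simp: C1_bounded_on_def cong: continuous_on_cong image_cong)
qed

lemma C1_bounded_on_linear:
  assumes L: "bounded_linear L" and f: "C1_bounded_on S f"
  shows "C1_bounded_on S (\<lambda>x. L (f x))"
proof -
  have eq: "pd j (\<lambda>x. L (f x)) x = L (pd j f x)" if "x \<in> S" for x j
    using f that by (intro pd_bounded_linear L) (auto simp: C1_bounded_on_def)
  have "continuous_on S (\<lambda>x. L (pd j f x))" "bounded ((\<lambda>x. L (pd j f x)) ` S)"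
    "bounded ((\<lambda>x. L (f x)) ` S)" for j
    using f by (auto simp: C1_bounded_on_def
        intro!: bounded_linear.continuous_on[OF L] bounded_linear_image_comp[OF L])
  moreover have "(\<lambda>x. L (f x)) differentiable (at x)" if "x \<in> S" for x
    using f that bounded_linear.has_derivative[OF L]
    unfolding C1_bounded_on_def differentiable_def by blast
  ultimately show ?thesis
    using eq by (auto simp: C1_bounded_on_def cong: continuous_on_cong image_cong)
qed

text \<open>One product rule covers the products of a field \<open>J\<close> with \<open>w i\<close>
  and with \<open>u\<close>.\<close>

lemma C1_bounded_on_bilinear:
  assumes h: "bounded_bilinear h" and f: "C1_bounded_on S f" and g: "C1_bounded_on S g"
  shows "C1_bounded_on S (\<lambda>x. h (f x) (g x))"
proof -
  have eq: "pd j (\<lambda>x. h (f x) (g x)) x = h (f x) (pd j g x) + h (pd j f x) (g x)" if "x \<in> S" for x j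
    using f g that by (intro pd_bounded_bilinear h) (auto simp: C1_bounded_on_def)
  have "continuous_on S (\<lambda>x. h (f x) (pd j g x) + h (pd j f x) (g x))"
    "bounded ((\<lambda>x. h (f x) (pd j g x) + h (pd j f x) (g x)) ` S)"
    "bounded ((\<lambda>x. h (f x) (g x)) ` S)" for j
    using f g C1_bounded_on_continuous[OF f] C1_bounded_on_continuous[OF g]
    by (auto simp: C1_bounded_on_def intro!: continuous_on_add bounded_plus_comp
        bounded_bilinear.continuous_on[OF h] bounded_bilinear_image[OF h])
  moreover have "(\<lambda>x. h (f x) (g x)) differentiable (at x)" if "x \<in> S" for x
    using f g that bounded_bilinear.FDERIV[OF h]
    unfolding C1_bounded_on_def differentiable_def by blast
  ultimately show ?thesis
    using eq by (auto simp: C1_bounded_on_def cong: continuous_on_cong image_cong)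
qed

lemma C1_bounded_on_sum:
  "(\<And>i. i \<in> I \<Longrightarrow> C1_bounded_on S (f i)) \<Longrightarrow> C1_bounded_on S (\<lambda>x. \<Sum>i\<in>I. f i x)"
proof (induction I rule: infinite_finite_induct)
  case (insert i I)
  then show ?case using C1_bounded_on_add[of S "f i" "\<lambda>x. \<Sum>i\<in>I. f i x"] by simp
qed (auto intro: C1_bounded_on_const)

lemma C1_bounded_on_transform:
  assumes S: "open S" and f: "C1_bounded_on S f" and eq: "\<And>x. x \<in> S \<Longrightarrow> f x = g x"
  shows "C1_bounded_on S g"
proof -
  have d: "g differentiable (at x)" "pd j g x = pd j f x" if "x \<in> S" for x j
    using f that S eq differentiable_transform_open[of f x S g] pd_transform_open[of f x S g]
    by (auto simp: C1_bounded_on_def)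
  then show ?thesis
    using f eq[symmetric] by (auto simp: C1_bounded_on_def cong: continuous_on_cong image_cong)
qed

section \<open>Smooth functions\<close>

lemma smooth_pd: "smooth f \<Longrightarrow> smooth (pd j f)"
  unfolding smooth_def
proof (intro allI)
  fix js x assume "\<forall>js x. foldr pd js f differentiable (at x)"
  \<comment> \<open>Under \<open>foldr\<close> the last entry of the list acts first, so
    \<open>j\<close> is appended at the end.\<close>
  then have "foldr pd (js @ [j]) f differentiable (at x)" by blast
  then show "foldr pd js (pd j f) differentiable (at x)" by simp
qed

lemma smooth_differentiable: "smooth f \<Longrightarrow> f differentiable (at x)"
  unfolding smooth_def by (metis foldr.simps(1) id_apply)

lemma smooth_continuous: "smooth f \<Longrightarrow> continuous_on UNIV f"
  by (intro differentiable_imp_continuous_on differentiable_at_imp_differentiable_on)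
    (auto intro: smooth_differentiable)

text \<open>Smoothness on the whole space gives continuity on the compact closure of
  \<open>S\<close>, hence bounds.\<close>

lemma smooth_C1_bounded_on:
  fixes f :: "real^'d::finite \<Rightarrow> 'v::real_normed_vector"
  assumes "smooth f" "bounded S"
  shows "C1_bounded_on S f"
proof -
  have bdd: "bounded (g ` S)" if "smooth g" for g :: "real^'d \<Rightarrow> 'v"
  proof -
    have "compact (g ` closure S)"
      using assms(2) smooth_continuous[OF that] continuous_on_subset
      by (intro compact_continuous_image) (auto simp: compact_closure)
    then show ?thesis
      using bounded_subset[OF compact_imp_bounded] closure_subset by (metis image_mono)
  qed
  show ?thesis
    unfolding C1_bounded_on_def
    using assms smooth_differentiable bdd smooth_pd continuous_on_subset[OF smooth_continuous]
    by blast
qed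

lemma smooth_const:
  fixes c :: "'v::real_normed_vector"
  shows "smooth (\<lambda>_ :: real^'d::finite. c)"
proof -
  have *: "\<exists>e. foldr pd js (\<lambda>_. c) = (\<lambda>_. e)" for js :: "'d list" by (induction js) auto
  show ?thesis
    unfolding smooth_def
  proof (intro allI)
    fix js :: "'d list" and x :: "real^'d"
    from *[of js] obtain e where eq: "foldr pd js (\<lambda>_. c) = (\<lambda>_. e)" by metis
    show "foldr pd js (\<lambda>_. c) differentiable (at x)"
      unfolding eq by (rule differentiable_const)
  qed
qed

lemma smooth_add:
  assumes "smooth f" "smooth g"
  shows "smooth (\<lambda>x. f x + g x)"
proof -
  have "foldr pd js (\<lambda>x. f x + g x) = (\<lambda>x. foldr pd js f x + foldr pd js g x)" for js
  proof (induction js)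
    case (Cons j js)
    then show ?case using assms by (auto simp: smooth_def pd_add)
  qed simp
  then show ?thesis using assms by (auto simp: smooth_def intro!: differentiable_add)
qed

lemma smooth_scaleR:
  assumes "smooth f"
  shows "smooth (\<lambda>x. r *\<^sub>R f x)"
proof -
  have "foldr pd js (\<lambda>x. r *\<^sub>R f x) = (\<lambda>x. r *\<^sub>R foldr pd js f x)" for js
  proof (induction js)
    case (Cons j js)
    then show ?case
      using assms by (auto simp: smooth_def pd_bounded_linear[OF bounded_linear_scaleR_right])
  qed simp
  then show ?thesis using assms by (auto simp: smooth_def intro!: differentiable_scaleR)
qed

section \<open>Divergence and gradient as linear expressions in partial derivatives\<close>

lemma tdvg_eq: "tdvg f x = (\<Sum>j\<in>UNIV. pd j f x $ j)"
  by (simp add: tdvg_def vec_eq_iff)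

lemma tdvg_zero: "tdvg (\<lambda>_. 0) x = 0"
  by (simp add: tdvg_eq)

lemma tdvg_add:
  "f differentiable (at x) \<Longrightarrow> g differentiable (at x) \<Longrightarrow> tdvg (\<lambda>y. f y + g y) x = tdvg f x + tdvg g x"
  by (simp add: tdvg_eq pd_add sum.distrib)

lemma tdvg_scaleR: "f differentiable (at x) \<Longrightarrow> tdvg (\<lambda>y. r *\<^sub>R f y) x = r *\<^sub>R tdvg f x"
  by (simp add: tdvg_eq pd_bounded_linear[OF bounded_linear_scaleR_right] scaleR_sum_right)

lemma C1_bounded_on_tdvg: "smooth f \<Longrightarrow> bounded S \<Longrightarrow> C1_bounded_on S (tdvg f)"
  unfolding tdvg_eq[abs_def]
  by (intro C1_bounded_on_sum C1_bounded_on_linear[OF bounded_linear_vec_nth]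
      smooth_C1_bounded_on smooth_pd)

text \<open>Since \<open>axis j\<close> is bounded and linear, this form hands linearity, continuity
  and bounds from \<open>pd j v\<close> to \<open>grad v\<close>.\<close>

lemma grad_eq: "grad v x = (\<Sum>j\<in>UNIV. axis j (pd j v x))"
  by (simp add: grad_def vec_eq_iff axis_def if_distrib[of "\<lambda>v. v $ _"] cong: if_cong)

lemma
  assumes "v differentiable (at x)" "v' differentiable (at x)"
  shows grad_add: "grad (\<lambda>y. v y + v' y) x = grad v x + grad v' x"
    and dvg_add: "dvg (\<lambda>y. v y + v' y) x = dvg v x + dvg v' x"
  using assms
  by (simp_all add: grad_eq dvg_def pd_add sum.distrib linear_add[OF bounded_linear.linear[OF bounded_linear_axis]])

lemma
  assumes "v differentiable (at x)"
  shows grad_scaleR: "grad (\<lambda>y. r *\<^sub>R v y) x = r *\<^sub>R grad v x"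
    and dvg_scaleR: "dvg (\<lambda>y. r *\<^sub>R v y) x = r * dvg v x"
  using assms
  by (simp_all add: grad_eq dvg_def pd_bounded_linear[OF bounded_linear_scaleR_right]
      scaleR_sum_right sum_distrib_left linear_cmul[OF bounded_linear.linear[OF bounded_linear_axis]])

lemma
  assumes "C1_bounded_on S v"
  shows grad_continuous: "continuous_on S (grad v)" and grad_bounded: "bounded (grad v ` S)"
    and dvg_continuous: "continuous_on S (dvg v)" and dvg_bounded: "bounded (dvg v ` S)"
  using assms unfolding grad_eq[abs_def] dvg_def[abs_def] C1_bounded_on_def
  by (auto intro!: continuous_on_sum bounded_linear.continuous_on[OF bounded_linear_axis]
      bounded_sum_comp bounded_linear_image_comp[OF bounded_linear_axis]
      bounded_linear_image_comp[OF bounded_linear_vec_nth] bounded_linear.continuous_on[OF bounded_linear_vec_nth])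

section \<open>The form on bounded fields\<close>

text \<open>A class wide enough for the merely measurable coefficients \<open>\<eta>\<close> and
  \<open>\<zeta>\<close>, closed under bilinear products, and integrable over sets of finite
  measure.\<close>

definition bounded_measurable :: "'a::euclidean_space set \<Rightarrow> ('a \<Rightarrow> 'b::euclidean_space) \<Rightarrow> bool" where
  "bounded_measurable X f \<longleftrightarrow> f \<in> borel_measurable (lebesgue_on X) \<and> bounded (f ` X)"

lemma bounded_measurable_continuous:
  "open X \<Longrightarrow> continuous_on X f \<Longrightarrow> bounded (f ` X) \<Longrightarrow> bounded_measurable X f"
  unfolding bounded_measurable_def
  by (auto intro: continuous_imp_measurable_on_sets_lebesgue)

lemma bounded_measurable_bilinear:
  assumes h: "bounded_bilinear h" and "bounded_measurable X f" "bounded_measurable X g"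
  shows "bounded_measurable X (\<lambda>x. h (f x) (g x))"
proof -
  have "continuous_on UNIV (\<lambda>p. h (fst p) (snd p))"
    by (intro bounded_bilinear.continuous_on[OF h] continuous_intros)
  then show ?thesis
    using assms unfolding bounded_measurable_def
    by (intro conjI bounded_bilinear_image[OF h] borel_measurable_continuous_Pair[where H=h]) blast+
qed

lemma bounded_measurable_sum:
  "(\<And>i. i \<in> I \<Longrightarrow> bounded_measurable X (f i)) \<Longrightarrow> bounded_measurable X (\<lambda>x. \<Sum>i\<in>I. f i x)"
  unfolding bounded_measurable_def by (intro conjI borel_measurable_sum bounded_sum_comp) auto

lemma bounded_measurable_integrable:
  assumes "X \<in> lmeasurable" "bounded_measurable X f"
  shows "integrable (lebesgue_on X) f"
proof -
  obtain C where "\<And>x. x \<in> X \<Longrightarrow> norm (f x) \<le> C"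
    using assms(2) by (auto simp: bounded_measurable_def bounded_iff)
  then show ?thesis
    using assms(2) by (intro finite_measure.integrable_const_bound[OF finite_measure_lebesgue_on[OF assms(1)], of _ C])
      (auto simp: bounded_measurable_def)
qed

text \<open>A matrix product acts column by column, so this reduces claims on \<open>A ** M\<close>
  to claims on \<open>A *v x\<close>.\<close>

lemma inner_columns:
  fixes M N :: "real^'n::finite^'k::finite"
  shows "M \<bullet> N = (\<Sum>j\<in>UNIV. column j M \<bullet> column j N)"
  unfolding inner_vec_def column_def by (simp, rule sum.swap)

lemma column_matrix_mult: "column j (A ** B) = A *v column j (B :: real^'n^'k)"
  by (simp add: column_def matrix_matrix_mult_def matrix_vector_mult_def vec_eq_iff)

lemma inner_matrix_mult_commute:
  fixes A :: "real^'n^'n" and M N :: "real^'k^'n"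
  assumes "transpose A = A"
  shows "(A ** M) \<bullet> N = (A ** N) \<bullet> M"
proof -
  have "(A *v x) \<bullet> y = (A *v y) \<bullet> x" for x y
    using dot_lmul_matrix[of x A y] assms transpose_matrix_vector[of A x] by (simp add: inner_commute)
  then show ?thesis by (simp add: inner_columns column_matrix_mult)
qed

lemma inner_matrix_mult_nonneg:
  fixes A :: "real^'n^'n" and M :: "real^'k^'n"
  assumes "\<And>v. 0 \<le> v \<bullet> (A *v v)"
  shows "0 \<le> (A ** M) \<bullet> M"
  unfolding inner_columns column_matrix_mult by (intro sum_nonneg) (metis assms inner_commute)

text \<open>The data that the form sees on \<open>X\<close>, the same for periodic and Dirichlet
  conditions.\<close>

locale form_data =
  fixes X :: "(real^'d::finite) set"
    and w :: "nat \<Rightarrow> real^'d \<Rightarrow> real^'m::finite"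
    and u :: "real^'d \<Rightarrow> real^'m"
    and \<eta> :: "real^'d \<Rightarrow> real^'d^'d"
    and \<zeta> :: "real^'d \<Rightarrow> real"
  assumes open_X: "open X" and bounded_X: "bounded X"
    and C1_w: "i < CARD('m) - 1 \<Longrightarrow> C1_bounded_on X (w i)" and C1_u: "C1_bounded_on X u"
    and bm_eta: "bounded_measurable X \<eta>" and bm_zeta: "bounded_measurable X \<zeta>"
    and eta_sym: "x \<in> X \<Longrightarrow> transpose (\<eta> x) = \<eta> x"
    and eta_nonneg: "x \<in> X \<Longrightarrow> 0 \<le> v \<bullet> (\<eta> x *v v)"
    and zeta_nonneg: "x \<in> X \<Longrightarrow> 0 \<le> \<zeta> x"
begin

definition G :: "(real^'d \<Rightarrow> real^'m^'d) \<Rightarrow> real^'d \<Rightarrow> real^'d^'d" where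
  "G J = grad (\<lambda>y. J y *v u y)"

definition D :: "(real^'d \<Rightarrow> real^'m^'d) \<Rightarrow> real^'d \<Rightarrow> real" where
  "D J = dvg (\<lambda>y. J y *v u y)"

text \<open>A single integrand for the three terms, so that symmetry, positivity and linearity can
  be checked pointwise.\<close>

definition density :: "(real^'d \<Rightarrow> real^'m^'d) \<Rightarrow> (real^'d \<Rightarrow> real^'m^'d) \<Rightarrow> real^'d \<Rightarrow> real" where
  "density J K x = (\<Sum>i<CARD('m) - 1. (J x *v w i x) \<bullet> (K x *v w i x)) +
     (\<eta> x ** G J x) \<bullet> G K x + (\<zeta> x * D J x) * D K x"

abbreviation "W \<equiv> {J :: real^'d \<Rightarrow> real^'m^'d. C1_bounded_on X J}"

lemma C1_Ju: "J \<in> W \<Longrightarrow> C1_bounded_on X (\<lambda>y. J y *v u y)"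
  using C1_bounded_on_bilinear[OF bounded_bilinear_matrix_vector _ C1_u] by simp

lemma differentiable_Ju: "J \<in> W \<Longrightarrow> x \<in> X \<Longrightarrow> (\<lambda>y. J y *v u y) differentiable (at x)"
  using C1_Ju by (simp add: C1_bounded_on_def)

lemma
  assumes "J \<in> W" "K \<in> W" "x \<in> X"
  shows G_add: "G (J + K) x = G J x + G K x" and D_add: "D (J + K) x = D J x + D K x"
  using assms differentiable_Ju
  by (simp_all add: G_def D_def matrix_vector_mult_add_rdistrib grad_add dvg_add)

lemma
  assumes "J \<in> W" "x \<in> X"
  shows G_scaleR: "G (\<lambda>x. r *\<^sub>R J x) x = r *\<^sub>R G J x"
    and D_scaleR: "D (\<lambda>x. r *\<^sub>R J x) x = r * D J x"
  using assms differentiable_Ju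
  by (simp_all add: G_def D_def scaleR_matrix_vector_assoc[symmetric] grad_scaleR dvg_scaleR)

lemma density_add:
  "J \<in> W \<Longrightarrow> K \<in> W \<Longrightarrow> x \<in> X \<Longrightarrow> density (J + K) H x = density J H x + density K H x"
  by (simp add: density_def G_add D_add matrix_add_ldistrib matrix_vector_mult_add_rdistrib
      inner_add_left sum.distrib distrib_left distrib_right)

lemma density_scaleR:
  assumes "J \<in> W" "x \<in> X"
  shows "density (\<lambda>x. r *\<^sub>R J x) K x = r * density J K x"
proof -
  have "\<eta> x ** (r *\<^sub>R G J x) = r *\<^sub>R (\<eta> x ** G J x)"
    by (rule bounded_bilinear.scaleR_right[OF bounded_bilinear_matrix_mult])
  then show ?thesis
    using assms by (simp add: density_def G_scaleR D_scaleR scaleR_matrix_vector_assoc[symmetric]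
        sum_distrib_left distrib_left)
qed

lemma density_commute: "x \<in> X \<Longrightarrow> density J K x = density K J x"
  using inner_matrix_mult_commute[OF eta_sym, of x "G J x" "G K x"]
  by (simp add: density_def inner_commute)

lemma density_nonneg: "x \<in> X \<Longrightarrow> 0 \<le> density J J x"
  unfolding density_def using zeta_nonneg[of x]
  by (intro add_nonneg_nonneg sum_nonneg inner_ge_zero inner_matrix_mult_nonneg eta_nonneg)
    (auto simp: mult.assoc)

lemma lmeasurable_X: "X \<in> lmeasurable"
  by (rule lmeasurable_open[OF bounded_X open_X])

text \<open>For fields in \<open>W\<close> every factor is bounded and measurable on
  \<open>X\<close>, which has finite measure.\<close>

lemma
  assumes "J \<in> W" "K \<in> W"
  shows integrable_w: "integrable (lebesgue_on X) (\<lambda>x. \<Sum>i<CARD('m) - 1. (J x *v w i x) \<bullet> (K x *v w i x))"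
    and integrable_G: "integrable (lebesgue_on X) (\<lambda>x. (\<eta> x ** G J x) \<bullet> G K x)"
    and integrable_D: "integrable (lebesgue_on X) (\<lambda>x. (\<zeta> x * D J x) * D K x)"
proof -
  have C1: "bounded_measurable X g" if "C1_bounded_on X g" for g :: "real^'d \<Rightarrow> real^'d"
    using that C1_bounded_on_continuous[OF that]
    by (auto intro: bounded_measurable_continuous[OF open_X] simp: C1_bounded_on_def)
  have Jw: "bounded_measurable X (\<lambda>x. H x *v w i x)" if "H \<in> W" "i < CARD('m) - 1" for H i
    using that by (intro C1 C1_bounded_on_bilinear[OF bounded_bilinear_matrix_vector] C1_w) auto
  have GD: "bounded_measurable X (G H)" "bounded_measurable X (D H)" if "H \<in> W" for H
    unfolding G_def D_def using C1_Ju[OF that]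
    by (auto intro: bounded_measurable_continuous[OF open_X]
        grad_continuous grad_bounded dvg_continuous dvg_bounded)
  show "integrable (lebesgue_on X) (\<lambda>x. \<Sum>i<CARD('m) - 1. (J x *v w i x) \<bullet> (K x *v w i x))"
    using assms by (intro bounded_measurable_integrable[OF lmeasurable_X] bounded_measurable_sum
        bounded_measurable_bilinear[OF bounded_bilinear_inner] Jw) auto
  show "integrable (lebesgue_on X) (\<lambda>x. (\<eta> x ** G J x) \<bullet> G K x)"
    using assms by (intro bounded_measurable_integrable[OF lmeasurable_X]
        bounded_measurable_bilinear[OF bounded_bilinear_inner]
        bounded_measurable_bilinear[OF bounded_bilinear_matrix_mult] bm_eta GD)
  show "integrable (lebesgue_on X) (\<lambda>x. (\<zeta> x * D J x) * D K x)"
    using assms by (intro bounded_measurable_integrable[OF lmeasurable_X]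
        bounded_measurable_bilinear[OF bounded_bilinear_mult] bm_zeta GD)
qed

lemma integrable_density: "J \<in> W \<Longrightarrow> K \<in> W \<Longrightarrow> integrable (lebesgue_on X) (density J K)"
  unfolding density_def[abs_def]
  by (intro Bochner_Integration.integrable_add integrable_w integrable_G integrable_D)

text \<open>Merging the three integrals relies on their integrability, hence on membership in
  \<open>W\<close>.\<close>

lemma form_eq:
  "J \<in> W \<Longrightarrow> K \<in> W \<Longrightarrow> form X w u \<eta> \<zeta> J K = (LINT x|lebesgue_on X. density J K x)"
  unfolding density_def form_def G_def[symmetric] D_def[symmetric]
  by (simp only: Bochner_Integration.integral_add Bochner_Integration.integrable_add
      integrable_w integrable_G integrable_D)

end


section \<open>Currents\<close>

interpretation pointwise: vector_space "\<lambda>r (f :: 'a \<Rightarrow> 'b::real_vector) x. r *\<^sub>R f x"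
  by unfold_locales (auto simp: fun_eq_iff scaleR_add_right scaleR_add_left)

lemma (in form_data) psd_form: "psd_form (\<lambda>r f x. r *\<^sub>R f x) W (form X w u \<eta> \<zeta>)"
proof (intro psd_form.intro psd_form_axioms.intro pointwise.vector_space_axioms)
  have W: "J + K \<in> W" "(\<lambda>x. r *\<^sub>R J x) \<in> W" if "J \<in> W" "K \<in> W" for J K r
    using that C1_bounded_on_add C1_bounded_on_linear[OF bounded_linear_scaleR_right]
    by (auto simp: plus_fun_def)
  show "pointwise.subspace W"
    unfolding pointwise.subspace_def using W by (auto simp: zero_fun_def C1_bounded_on_const)
  fix J K H :: "real^'d \<Rightarrow> real^'m^'d" and r :: real
  let ?a = "form X w u \<eta> \<zeta>"
  have integral_cong: "(LINT x|lebesgue_on X. f x) = (LINT x|lebesgue_on X. g x)"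
    if "\<And>x. x \<in> X \<Longrightarrow> f x = g x" for f g :: "real^'d \<Rightarrow> real"
    using that by (intro Bochner_Integration.integral_cong) auto
  assume J: "J \<in> W"
  show "0 \<le> ?a J J"
    unfolding form_eq[OF J J] by (intro Bochner_Integration.integral_nonneg) (simp add: density_nonneg)
  assume K: "K \<in> W"
  show "?a J K = ?a K J"
    unfolding form_eq[OF J K] form_eq[OF K J] by (intro integral_cong density_commute)
  show "?a (\<lambda>x. r *\<^sub>R J x) K = r * ?a J K"
    unfolding form_eq[OF J K] form_eq[OF W(2)[OF J J] K] Bochner_Integration.integral_mult_right_zero[symmetric]
    by (intro integral_cong density_scaleR J)
  assume H: "H \<in> W"
  show "?a (J + K) H = ?a J H + ?a K H"
    unfolding form_eq[OF J H] form_eq[OF K H] form_eq[OF W(1)[OF J K] H]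
      Bochner_Integration.integral_add[OF integrable_density[OF J H] integrable_density[OF K H], symmetric]
    by (intro integral_cong density_add J K)
qed

text \<open>The Dirichlet limit is linear in \<open>tdvg f\<close>, and smoothness supplies the
  differentiability that makes \<open>tdvg\<close> additive.\<close>

lemma boundary_condition_add:
  assumes "smooth f" "smooth g" "boundary_condition bc X u f" "boundary_condition bc X u g"
  shows "boundary_condition bc X u (\<lambda>x. f x + g x)"
proof (cases bc)
  case (Periodic L)
  then show ?thesis using assms by (simp add: periodic_def)
next
  case Dirichlet
  have "tdvg (\<lambda>x. f x + g x) x = tdvg f x + tdvg g x" for x
    using assms by (intro tdvg_add smooth_differentiable)
  moreover have "((\<lambda>x. tdvg f x *v u x + tdvg g x *v u x) \<longlongrightarrow> 0) (at p within X)"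
    if "p \<in> frontier X" for p
    using Dirichlet assms(3,4) that by (intro tendsto_add_zero) auto
  ultimately show ?thesis
    using Dirichlet assms by (simp add: matrix_vector_mult_add_rdistrib)
qed

lemma boundary_condition_scaleR:
  assumes "smooth f" "boundary_condition bc X u f"
  shows "boundary_condition bc X u (\<lambda>x. r *\<^sub>R f x)"
proof (cases bc)
  case (Periodic L)
  then show ?thesis using assms by (simp add: periodic_def)
next
  case Dirichlet
  have "tdvg (\<lambda>x. r *\<^sub>R f x) x = r *\<^sub>R tdvg f x" for x
    using assms by (intro tdvg_scaleR smooth_differentiable)
  moreover have "((\<lambda>x. r *\<^sub>R (tdvg f x *v u x)) \<longlongrightarrow> 0) (at p within X)"
    if "p \<in> frontier X" for p
  proof -
    have "((\<lambda>x. tdvg f x *v u x) \<longlongrightarrow> 0) (at p within X)" using Dirichlet assms(2) that by simp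
    from tendsto_scaleR[OF tendsto_const this, of r] show ?thesis by simp
  qed
  ultimately show ?thesis
    using Dirichlet assms by (simp add: scaleR_matrix_vector_assoc[symmetric])
qed

lemma currentsI:
  "smooth f \<Longrightarrow> antisymmetric f \<Longrightarrow> boundary_condition bc X u f \<Longrightarrow>
    J = (\<lambda>x. if x \<in> X then tdvg f x else 0) \<Longrightarrow> J \<in> currents bc X u"
  unfolding currents_def by blast

lemma currentsE:
  assumes "J \<in> currents bc X u"
  obtains f where "smooth f" "antisymmetric f" "boundary_condition bc X u f"
    "J = (\<lambda>x. if x \<in> X then tdvg f x else 0)"
  using assms unfolding currents_def by blast

text \<open>Linear operations are carried out on the potentials; extension by zero commutes with
  them.\<close>

lemma subspace_currents: "pointwise.subspace (currents bc X u)"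
proof (rule pointwise.subspaceI)
  show "0 \<in> currents bc X u"
  proof (rule currentsI)
    show "smooth (\<lambda>_. 0)" by (rule smooth_const)
    show "antisymmetric (\<lambda>_. 0)" by (simp add: antisymmetric_def)
    show "boundary_condition bc X u (\<lambda>_. 0)"
      by (cases bc) (simp_all add: periodic_def tdvg_zero)
    show "0 = (\<lambda>x. if x \<in> X then tdvg (\<lambda>_. 0) x else 0)"
      by (rule ext) (simp add: tdvg_zero)
  qed
next
  fix J K assume "J \<in> currents bc X u" "K \<in> currents bc X u"
  then obtain f g where f: "smooth f" "antisymmetric f" "boundary_condition bc X u f"
    "J = (\<lambda>x. if x \<in> X then tdvg f x else 0)"
    and g: "smooth g" "antisymmetric g" "boundary_condition bc X u g"
    "K = (\<lambda>x. if x \<in> X then tdvg g x else 0)"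
    by (elim currentsE) blast
  show "J + K \<in> currents bc X u"
  proof (rule currentsI[OF smooth_add[OF f(1) g(1)] _ boundary_condition_add[OF f(1) g(1) f(3) g(3)]])
    have "(f x + g x) $ j $ l $ k + (f x + g x) $ l $ j $ k
        = (f x $ j $ l $ k + f x $ l $ j $ k) + (g x $ j $ l $ k + g x $ l $ j $ k)" for x j l k
      by simp
    then show "antisymmetric (\<lambda>x. f x + g x)"
      using f(2) g(2) unfolding antisymmetric_def by (simp only: add_0 simp_thms)
    show "J + K = (\<lambda>x. if x \<in> X then tdvg (\<lambda>x. f x + g x) x else 0)"
      using f(1,4) g(1,4) by (auto simp: tdvg_add smooth_differentiable)
  qed
next
  fix J r assume "J \<in> currents bc X u"
  then obtain f where f: "smooth f" "antisymmetric f" "boundary_condition bc X u f"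
    "J = (\<lambda>x. if x \<in> X then tdvg f x else 0)"
    by (rule currentsE)
  show "(\<lambda>x. r *\<^sub>R J x) \<in> currents bc X u"
  proof (rule currentsI[OF smooth_scaleR[OF f(1)] _ boundary_condition_scaleR[OF f(1,3)]])
    show "antisymmetric (\<lambda>x. r *\<^sub>R f x)"
      using f(2) by (simp add: antisymmetric_def distrib_left[symmetric])
    show "(\<lambda>x. r *\<^sub>R J x) = (\<lambda>x. if x \<in> X then tdvg (\<lambda>x. r *\<^sub>R f x) x else 0)"
      using f(1,4) by (auto simp: tdvg_scaleR smooth_differentiable)
  qed
qed

text \<open>The extension by zero may jump at the boundary, but only the open set \<open>X\<close>
  matters, and there the current is \<open>tdvg f\<close> with \<open>f\<close> smooth on the whole
  space.\<close>

lemma currents_C1_bounded_on: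
  assumes "open X" "bounded X" "J \<in> currents bc X u"
  shows "C1_bounded_on X J"
proof -
  obtain f where "smooth f" and J: "J = (\<lambda>x. if x \<in> X then tdvg f x else 0)"
    using assms(3) by (elim currentsE) blast
  then show ?thesis
    using assms by (intro C1_bounded_on_transform[OF _ C1_bounded_on_tdvg]) auto
qed

lemma is_domainD:
  assumes "is_domain bc X"
  shows "open X" "bounded X" "X \<noteq> {}"
proof -
  have "open X \<and> bounded X \<and> X \<noteq> {}"
  proof (cases bc)
    case (Periodic L)
    then have inv: "invertible L" and X: "X = (*v) L ` box 0 1"
      using assms by (auto simp: box_def Basis_vec_def inner_axis)
    \<comment> \<open>The cell is a linear image of the open unit cube, and a surjective linear map
      is open.\<close>
    have "surj ((*v) L)"
      using inv matrix_right_invertible_surjective[of L] by (auto simp: invertible_def)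
    then have "open X" unfolding X by (intro open_surjective_linear_image) auto
    moreover have "bounded X" unfolding X by (intro bounded_linear_image bounded_box) auto
    \<comment> \<open>The centre of the cube shows that the cell is nonempty.\<close>
    moreover have "(\<chi> i. 1/2) \<in> box 0 (1::real^'a)" by (simp add: mem_box_cart)
    ultimately show ?thesis unfolding X by auto
  qed (use assms in auto)
  then show "open X" "bounded X" "X \<noteq> {}" by auto
qed

text \<open>Periodic fields are restricted from the whole space to the cell; here the two boundary
  conditions meet in one setting.\<close>

lemma C1_field_bounded_on: "C1_field bc X g \<Longrightarrow> C1_bounded_on X g"
  by (cases bc) (auto intro: C1_bounded_on_subset)

theorem lemma2p7:
  fixes bc :: "'d::finite bc"
    and X :: "(real^'d) set"
    and a w :: "nat \<Rightarrow> real^'d \<Rightarrow> real^'m::finite"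
    and b u :: "real^'d \<Rightarrow> real^'m"
    and \<eta> :: "real^'d \<Rightarrow> real^'d^'d"
    and \<eta>0 :: real
    and \<zeta> :: "real^'d \<Rightarrow> real"
  defines "\<DD> \<equiv> currents bc X u"
    and "\<aa> \<equiv> form X w u \<eta> \<zeta>"
  assumes "is_domain bc X"
    and "\<And>i. i < CARD('m) - 1 \<Longrightarrow> C1_field bc X (a i)"
    and "C1_field bc X b"
    and "\<And>x. x \<in> field_dom bc X \<Longrightarrow> dim ((\<lambda>i. a i x) ` {..<CARD('m) - 1}) = CARD('m) - 1"
    and "\<And>x. x \<in> field_dom bc X \<Longrightarrow> span (insert (b x) ((\<lambda>i. a i x) ` {..<CARD('m) - 1})) = UNIV"
    and "\<And>i. i < CARD('m) - 1 \<Longrightarrow> C1_field bc X (w i)"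
    and "C1_field bc X u"
    and "\<And>x i j. x \<in> field_dom bc X \<Longrightarrow> i < CARD('m) - 1 \<Longrightarrow> j < CARD('m) - 1 \<Longrightarrow>
           w i x \<bullet> a j x = (if i = j then 1 else 0)"
    and "\<And>x i. x \<in> field_dom bc X \<Longrightarrow> i < CARD('m) - 1 \<Longrightarrow> w i x \<bullet> b x = 0"
    and "\<And>x j. x \<in> field_dom bc X \<Longrightarrow> j < CARD('m) - 1 \<Longrightarrow> u x \<bullet> a j x = 0"
    and "\<And>x. x \<in> field_dom bc X \<Longrightarrow> u x \<bullet> b x = 1"
    and "\<eta> \<in> borel_measurable (lebesgue_on X)"
    and "bounded (\<eta> ` X)"
    and "\<And>x. x \<in> X \<Longrightarrow> transpose (\<eta> x) = \<eta> x"
    and "\<eta>0 > 0"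
    and "\<And>x v. x \<in> X \<Longrightarrow> v \<bullet> (\<eta> x *v v) \<ge> \<eta>0 * (v \<bullet> v)"
    and "\<zeta> \<in> borel_measurable (lebesgue_on X)"
    and "bounded (\<zeta> ` X)"
    and "\<And>x. x \<in> X \<Longrightarrow> \<zeta> x \<ge> 0"
    and "oscillation X b > 0"
  shows "(\<forall>c. \<exists>!J. is_corrector \<DD> \<aa> c J) \<and>
         (\<exists>!A. is_effective_tensor X \<DD> \<aa> A) \<and>
         (\<forall>c. (\<exists>J\<in>cauchy_completion \<DD> \<aa>.
                 c \<bullet> effective_tensor X \<DD> \<aa> c =
                   1 / measure lebesgue X * ext_form \<aa> (c, J) (c, J)) \<and>
              (\<forall>J\<in>cauchy_completion \<DD> \<aa>.
                 c \<bullet> effective_tensor X \<DD> \<aa> c \<le>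
                   1 / measure lebesgue X * ext_form \<aa> (c, J) (c, J)))"
proof -
  note X = is_domainD[OF \<open>is_domain bc X\<close>]
  interpret form_data X w u \<eta> \<zeta>
  proof
    show "C1_bounded_on X (w i)" if "i < CARD('m) - 1" for i
      using assms(8)[OF that] by (rule C1_field_bounded_on)
    show "C1_bounded_on X u"
      using \<open>C1_field bc X u\<close> by (rule C1_field_bounded_on)
  next
    fix x and v :: "real^'d" assume "x \<in> X"
    have "0 \<le> \<eta>0 * (v \<bullet> v)" using \<open>\<eta>0 > 0\<close> by simp
    also have "\<dots> \<le> v \<bullet> (\<eta> x *v v)" using assms(18) \<open>x \<in> X\<close> by blast
    finally show "0 \<le> v \<bullet> (\<eta> x *v v)" .
  qed (use assms X in \<open>auto simp: bounded_measurable_def\<close>)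
  interpret function_form W \<aa> \<DD>
    unfolding \<aa>_def \<DD>_def
    by (intro function_form.intro psd_form function_form_axioms.intro subspace_currents)
      (auto simp: C1_bounded_on_const currents_C1_bounded_on[OF X(1,2)])
  \<comment> \<open>A nonempty open set is not negligible, so division by the volume is
    legitimate.\<close>
  have "measure lebesgue X \<noteq> 0"
    using negligible_iff_measure0[OF lmeasurable_X] open_not_negligible[OF X(1,3)] by blast
  then have pos: "measure lebesgue X > 0" by (simp add: zero_less_measure_iff)
  show ?thesis
  proof (intro conjI allI)
    fix c
    show "\<exists>!J. is_corrector \<DD> \<aa> c J" by (rule ex1_corrector)
    \<comment> \<open>The witness is the corrector, since \<open>eff c c\<close> is the energy there
      by definition.\<close>
    show "\<exists>J\<in>H. c \<bullet> effective_tensor X \<DD> \<aa> c = 1 / measure lebesgue X * ext_form \<aa> (c, J) (c, J)"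
      unfolding inner_effective_tensor[OF pos] eff_def using corr_in_H by blast
    show "\<forall>J\<in>H. c \<bullet> effective_tensor X \<DD> \<aa> c \<le> 1 / measure lebesgue X * ext_form \<aa> (c, J) (c, J)"
      unfolding inner_effective_tensor[OF pos]
      by (intro ballI mult_left_mono eff_le) simp_all
  qed (rule ex1_effective_tensor[OF pos])
qed

end
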